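(* There is a polynomial-time algorithm for the following problem (Decoder Retrieval): given a finite simple graph $G=(V,E)$, a finite alphabet $\Sigma$, a coloring $\chi\colon V\to\Sigma$ and a word $w\in\Sigma^{|V|}$, decide whether there exists a decoder $\mathcal{D}\subseteq\Sigma^2$ such that there is a graph isomorphism $f\colon V\to V(G(\mathcal{D},w))$ with $w_{f(v)}=\chi(v)$ for all $v\in V$.
   Context: For a decoder $\mathcal{D}\subseteq\Sigma^2$ and a word $w=w_1\cdots w_n\in\Sigma^*$, the letter graph $G(\mathcal{D},w)$ has vertex set $\{1,\dots,n\}$ and edge set $\{\{i,j\}\mid 1\le i<j\le n,\ w_iw_j\in\mathcal{D}\}$. For $a\in\Sigma$ let $V_a=\chi^{-1}(a)$; it is assumed throughout that $V_a\neq\emptyset$ for every $a\in\Sigma$ and that $w$ contains the letter $a$ exactly $|V_a|$ times. *)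

theory Defs
  imports "HOL-Library.FuncSet" "HOL-Library.Log_Nat" "HOL-Computational_Algebra.Polynomial"
begin

section \<open>Letter graphs and the Decoder Retrieval problem\<close>

type_synonym 'v graph = "'v set \<times> 'v set set"

definition finite_simple_graph :: "'v graph \<Rightarrow> bool" where
  "finite_simple_graph G \<longleftrightarrow> finite (fst G) \<and> (\<forall>e\<in>snd G. e \<subseteq> fst G \<and> card e = 2)"

definition graph_isomorphism :: "('u \<Rightarrow> 'v) \<Rightarrow> 'u graph \<Rightarrow> 'v graph \<Rightarrow> bool" where
  "graph_isomorphism f G H \<longleftrightarrow>
     bij_betw f (fst G) (fst H) \<and>
     (\<forall>u\<in>fst G. \<forall>v\<in>fst G. {u, v} \<in> snd G \<longleftrightarrow> {f u, f v} \<in> snd H)"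

text \<open>Positions in words are counted from 1, whereas \<open>!\<close> counts from 0.\<close>

definition letter_at :: "'a list \<Rightarrow> nat \<Rightarrow> 'a" where
  "letter_at w i = w ! (i - 1)"

definition letter_graph :: "('a \<times> 'a) set \<Rightarrow> 'a list \<Rightarrow> nat graph" where
  "letter_graph D w =
     ({1..length w},
      {{i, j} | i j. 1 \<le> i \<and> i < j \<and> j \<le> length w \<and> (letter_at w i, letter_at w j) \<in> D})"

record ('v, 'a) instance_data =
  graph :: "'v graph"
  alphabet :: "'a set"
  coloring :: "'v \<Rightarrow> 'a"
  word :: "'a list"

definition color_class :: "('v, 'a) instance_data \<Rightarrow> 'a \<Rightarrow> 'v set" where
  "color_class I a = {v \<in> fst (graph I). coloring I v = a}"

definition is_instance :: "('v, 'a) instance_data \<Rightarrow> bool" where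
  "is_instance I \<longleftrightarrow>
     finite_simple_graph (graph I) \<and>
     finite (alphabet I) \<and>
     coloring I \<in> fst (graph I) \<rightarrow> alphabet I \<and>
     set (word I) \<subseteq> alphabet I \<and>
     length (word I) = card (fst (graph I)) \<and>
     (\<forall>a\<in>alphabet I. color_class I a \<noteq> {} \<and>
                     count_list (word I) a = card (color_class I a))"

definition has_decoder :: "('v, 'a) instance_data \<Rightarrow> bool" where
  "has_decoder I \<longleftrightarrow>
     (\<exists>D \<subseteq> alphabet I \<times> alphabet I. \<exists>f.
        graph_isomorphism f (graph I) (letter_graph D (word I)) \<and>
        (\<forall>v\<in>fst (graph I). letter_at (word I) (f v) = coloring I v))"

text \<open>
  A sequence of natural numbers \<open>xs\<close> encodes an instance if, for some listing \<open>vs\<close> of the vertices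
  and some numbering \<open>num\<close> of the letters, it consists of the number of vertices, the number of
  letters, the adjacency matrix row by row, the colors of the vertices and the letters of the word.
  An instance may have several encodings, one for each choice of \<open>vs\<close> and \<open>num\<close>.
\<close>

definition encodes :: "('v, 'a) instance_data \<Rightarrow> nat list \<Rightarrow> bool" where
  "encodes I xs \<longleftrightarrow>
     (\<exists>vs num. distinct vs \<and> set vs = fst (graph I) \<and>
        bij_betw num (alphabet I) {..<card (alphabet I)} \<and>
        xs = [length vs, card (alphabet I)]
             @ concat (map (\<lambda>u. map (\<lambda>v. if {u, v} \<in> snd (graph I) then 1 else 0) vs) vs)
             @ map (\<lambda>v. num (coloring I v)) vs
             @ map num (word I))"


section \<open>Random access machines with logarithmic cost\<close>

text \<open>
  The model of computation is the random access machine under the logarithmic cost criterion (Aho,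
  Hopcroft and Ullman), which is polynomially equivalent to Turing machines. Programs are written
  with structured control flow, and the memory is divided into arrays of natural numbers; a program
  mentions only finitely many arrays, so that they can be interleaved in a single memory.
\<close>

type_synonym memory = "nat \<Rightarrow> nat \<Rightarrow> nat"

datatype expr =
    Const nat
  | Cell nat expr
  | Plus expr expr
  | Minus expr expr
  | Times expr expr

datatype program =
    Skip
  | Assign nat expr expr
  | Seq program program
  | Cond expr program program
  | While expr program

fun val :: "expr \<Rightarrow> memory \<Rightarrow> nat" where
  "val (Const n) s = n"
| "val (Cell a e) s = s a (val e s)"
| "val (Plus e1 e2) s = val e1 s + val e2 s"
| "val (Minus e1 e2) s = val e1 s - val e2 s"
| "val (Times e1 e2) s = val e1 s * val e2 s"

text \<open>Up to the additive 1, which keeps the cost of 0 positive, this is the number of binary digits.\<close>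

definition bits :: "nat \<Rightarrow> nat" where
  "bits n = floorlog 2 n + 1"

text \<open>
  Every subexpression, in particular every address, is charged the length of its value. Hence
  the total length of all numbers written in a run is at most its cost.
\<close>

fun cost :: "expr \<Rightarrow> memory \<Rightarrow> nat" where
  "cost (Const n) s = bits n"
| "cost (Cell a e) s = cost e s + bits (s a (val e s))"
| "cost (Plus e1 e2) s = cost e1 s + cost e2 s + bits (val e1 s + val e2 s)"
| "cost (Minus e1 e2) s = cost e1 s + cost e2 s + bits (val e1 s - val e2 s)"
| "cost (Times e1 e2) s = cost e1 s + cost e2 s + bits (val e1 s * val e2 s)"

text \<open>
  \<open>exec p s t s'\<close> means that \<open>p\<close>, started in memory \<open>s\<close>, halts in memory \<open>s'\<close> after time \<open>t\<close>.
  Tests succeed if their value is nonzero.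
\<close>

inductive exec :: "program \<Rightarrow> memory \<Rightarrow> nat \<Rightarrow> memory \<Rightarrow> bool" where
  Skip: "exec Skip s 1 s"
| Assign: "exec (Assign a e1 e2) s (cost e1 s + cost e2 s)
             (s(a := (s a)(val e1 s := val e2 s)))"
| Seq: "exec p s t s' \<Longrightarrow> exec q s' t' s'' \<Longrightarrow> exec (Seq p q) s (t + t') s''"
| CondTrue: "val e s \<noteq> 0 \<Longrightarrow> exec p s t s' \<Longrightarrow> exec (Cond e p q) s (cost e s + t) s'"
| CondFalse: "val e s = 0 \<Longrightarrow> exec q s t s' \<Longrightarrow> exec (Cond e p q) s (cost e s + t) s'"
| WhileFalse: "val e s = 0 \<Longrightarrow> exec (While e p) s (cost e s) s"
| WhileTrue: "val e s \<noteq> 0 \<Longrightarrow> exec p s t s' \<Longrightarrow> exec (While e p) s' t' s'' \<Longrightarrow>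
              exec (While e p) s (cost e s + t + t') s''"

lemma exec_deterministic:
  "exec p s t s' \<Longrightarrow> exec p s u s'' \<Longrightarrow> u = t \<and> s'' = s'"
proof (induction arbitrary: u s'' rule: exec.induct)
  case (Skip s)
  then show ?case by cases auto
next
  case (Assign a e1 e2 s)
  then show ?case by cases auto
next
  case (Seq p s t s1 q t' s2)
  from Seq.prems obtain x sx y
    where 1: "exec p s x sx" and 2: "exec q sx y s''" and u: "u = x + y"
    by cases (rule that)
  from Seq.IH(1)[OF 1] have x: "x = t" "sx = s1" by blast+
  from Seq.IH(2)[OF 2[unfolded x(2)]] show ?case unfolding u x(1) by simp
next
  case (CondTrue e s p t s1 q)
  from CondTrue.prems CondTrue.hyps obtain x where 1: "exec p s x s''" and u: "u = cost e s + x"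
    by cases simp_all
  from CondTrue.IH[OF 1] u show ?case by simp
next
  case (CondFalse e s q t s1 p)
  from CondFalse.prems CondFalse.hyps obtain x where 1: "exec q s x s''" and u: "u = cost e s + x"
    by cases simp_all
  from CondFalse.IH[OF 1] u show ?case by simp
next
  case (WhileFalse e s p)
  from WhileFalse.prems show ?case by cases (use WhileFalse.hyps in simp_all)
next
  case (WhileTrue e s p t s1 t' s2)
  from WhileTrue.prems WhileTrue.hyps(1) obtain x sx y
    where 1: "exec p s x sx" and 2: "exec (While e p) sx y s''" and u: "u = cost e s + x + y"
    by cases simp_all
  from WhileTrue.IH(1)[OF 1] have x: "x = t" "sx = s1" by blast+
  from WhileTrue.IH(2)[OF 2[unfolded x(2)]] show ?case unfolding u x(1) by simp
qed

text \<open>The input is stored in array 0, and all other cells are initially 0.\<close>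

definition input_memory :: "nat list \<Rightarrow> memory" where
  "input_memory xs = (\<lambda>a i. if a = 0 \<and> i < length xs then xs ! i else 0)"

definition input_size :: "nat list \<Rightarrow> nat" where
  "input_size xs = (\<Sum>x\<leftarrow>xs. bits x)"

definition accepting :: "memory \<Rightarrow> bool" where
  "accepting s \<longleftrightarrow> s 1 0 \<noteq> 0"

text \<open>
  \<open>p\<close> decides in polynomial time whether \<open>yes I\<close> holds for a given instance \<open>I\<close>, where \<open>inst\<close>
  singles out the instances and \<open>enc\<close> relates them to their encodings. By
  \<open>exec_deterministic\<close>, the run of \<open>p\<close> on an input is unique.
\<close>

definition decides_in_polynomial_time ::
    "program \<Rightarrow> ('i \<Rightarrow> bool) \<Rightarrow> ('i \<Rightarrow> nat list \<Rightarrow> bool) \<Rightarrow> ('i \<Rightarrow> bool) \<Rightarrow> bool" where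
  "decides_in_polynomial_time p inst enc yes \<longleftrightarrow>
     (\<exists>b :: nat poly. \<forall>I xs. inst I \<longrightarrow> enc I xs \<longrightarrow>
        (\<exists>t s. exec p (input_memory xs) t s \<and> t \<le> poly b (input_size xs) \<and>
               (accepting s \<longleftrightarrow> yes I)))"

end

theory Submission
  imports Defs "HOL-Library.Multiset"
begin

text \<open>
  Every color class must induce a complete or an empty graph.
  If all or no edges join the color classes of \<open>a\<close> and \<open>b\<close>, one may put both or none of \<open>(a, b)\<close>
  and \<open>(b, a)\<close> into the decoder, which imposes no constraint; otherwise exactly one of them must be
  chosen. Once the choices are made, a color-preserving bijection is an isomorphism iff it preserves
  the number of neighbors in every color, because a bipartite chain graph is determined by its
  degrees. Along the occurrences of a letter these numbers are monotone for each of the other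
  letters, so a suitable bijection exists iff for every two other letters the multisets of pairs of
  degrees agree. This is a condition on two choices at a time, that is, an instance of 2-SAT, which is
  decided by the transitive closure of its implication graph.

  All loops of the program range over the number of vertices, and
  stored numbers are only incremented; hence the running time is polynomial. Apart from
  the closure, the algorithm is a formula with bounded quantifiers and counting.
\<close>

section \<open>Polynomially bounded programs\<close>

text \<open>One bijection has to suit all pairs of letters at once, although the choice for each
  pair is made separately. Two facts make the problem local. The degree of a position with letter
  \<open>e\<close> into \<open>b\<close> depends only on the choice for \<open>e\<close> and
  \<open>b\<close>, so comparing the degrees into \<open>b\<close> and \<open>c\<close> on the class
  of \<open>e\<close> involves just two choices. And since the degrees are monotone along the
  positions, in whatever direction, they all induce compatible orders; this can be tested on two
  letters at a time, and then a single sorting matches all degrees simultaneously. The case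
  \<open>b = c\<close> is included: it makes a literal conflict with itself and thus yields the unit
  clauses. On the side of the machine, the danger is a loop that squares a cell again and again.
  Hence stored numbers may only grow by addition. The address of an entry of the implication matrix
  is a product, but addresses are evaluated without being stored.\<close>

lemma poly_nat_mono: "x \<le> y \<Longrightarrow> poly p x \<le> poly p y" for p :: "nat poly"
  by (induction p) (auto intro!: add_mono mult_mono)

text \<open>A linear bound on the logarithm is enough, because every stored number will be
  polynomial in the input size, not just its length.\<close>

lemma bits_le: "bits n \<le> n + 1"
proof -
  have "floorlog 2 n \<le> n" by (rule floorlog_leI) auto
  then show ?thesis by (simp add: bits_def)
qed

definition bounded_by :: "nat \<Rightarrow> memory \<Rightarrow> bool" where
  "bounded_by M s \<longleftrightarrow> (\<forall>a i. s a i \<le> M)"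

lemma bounded_by_mono: "bounded_by M s \<Longrightarrow> M \<le> M' \<Longrightarrow> bounded_by M' s"
  unfolding bounded_by_def by (meson order_trans)

text \<open>The expression is fixed, so even nested products give a polynomial; its degree depends
  on \<open>e\<close> alone.\<close>

lemma expr_bound:
  "\<exists>q. \<forall>s M. bounded_by M s \<longrightarrow> val e s \<le> poly q M \<and> cost e s \<le> poly q M"
proof (induction e)
  case (Const n)
  show ?case
    by (rule exI[of _ "[:n + 1:]"]) (use bits_le[of n] in auto)
next
  case (Cell a e)
  then obtain q where q: "\<And>s M. bounded_by M s \<Longrightarrow> cost e s \<le> poly q M" by blast
  show ?case
  proof (intro exI[of _ "q + [:1, 1:]"] allI impI)
    fix s M assume b: "bounded_by M s"
    then have "s a (val e s) \<le> M" by (simp add: bounded_by_def)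
    then show "val (Cell a e) s \<le> poly (q + [:1, 1:]) M \<and> cost (Cell a e) s \<le> poly (q + [:1, 1:]) M"
      using q[OF b] bits_le[of "s a (val e s)"] by simp
  qed
next
  case (Plus e1 e2)
  then obtain q1 q2
    where q1: "\<And>s M. bounded_by M s \<Longrightarrow> val e1 s \<le> poly q1 M \<and> cost e1 s \<le> poly q1 M"
      and q2: "\<And>s M. bounded_by M s \<Longrightarrow> val e2 s \<le> poly q2 M \<and> cost e2 s \<le> poly q2 M" by blast
  show ?case
  proof (intro exI[of _ "q1 + q1 + q2 + q2 + [:1:]"] allI impI)
    fix s M assume b: "bounded_by M s"
    then show "val (Plus e1 e2) s \<le> poly (q1 + q1 + q2 + q2 + [:1:]) M \<and>
        cost (Plus e1 e2) s \<le> poly (q1 + q1 + q2 + q2 + [:1:]) M"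
      using q1[OF b] q2[OF b] bits_le[of "val e1 s + val e2 s"] by simp
  qed
next
  case (Minus e1 e2)
  then obtain q1 q2
    where q1: "\<And>s M. bounded_by M s \<Longrightarrow> val e1 s \<le> poly q1 M \<and> cost e1 s \<le> poly q1 M"
      and q2: "\<And>s M. bounded_by M s \<Longrightarrow> val e2 s \<le> poly q2 M \<and> cost e2 s \<le> poly q2 M" by blast
  show ?case
  proof (intro exI[of _ "q1 + q1 + q2 + [:1:]"] allI impI)
    fix s M assume b: "bounded_by M s"
    then show "val (Minus e1 e2) s \<le> poly (q1 + q1 + q2 + [:1:]) M \<and>
        cost (Minus e1 e2) s \<le> poly (q1 + q1 + q2 + [:1:]) M"
      using q1[OF b] q2[OF b] bits_le[of "val e1 s - val e2 s"]
        diff_le_self[of "val e1 s" "val e2 s"] by (simp del: diff_le_self)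
  qed
next
  case (Times e1 e2)
  then obtain q1 q2
    where q1: "\<And>s M. bounded_by M s \<Longrightarrow> val e1 s \<le> poly q1 M \<and> cost e1 s \<le> poly q1 M"
      and q2: "\<And>s M. bounded_by M s \<Longrightarrow> val e2 s \<le> poly q2 M \<and> cost e2 s \<le> poly q2 M" by blast
  show ?case
  proof (intro exI[of _ "q1 + q2 + q1 * q2 + [:1:]"] allI impI)
    fix s M assume b: "bounded_by M s"
    have "val e1 s * val e2 s \<le> poly q1 M * poly q2 M"
      using q1[OF b] q2[OF b] by (intro mult_mono) auto
    then show "val (Times e1 e2) s \<le> poly (q1 + q2 + q1 * q2 + [:1:]) M \<and>
        cost (Times e1 e2) s \<le> poly (q1 + q2 + q1 * q2 + [:1:]) M"
      using q1[OF b] q2[OF b] bits_le[of "val e1 s * val e2 s"] by simp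
  qed
qed

text \<open>
  The cells grow only by an additive term, which is bounded in terms of the loop bound \<open>s 0 0\<close>
  alone. This is what makes the property closed under \<open>s 0 0\<close>-fold iteration.
\<close>

definition polytime :: "program \<Rightarrow> (memory \<Rightarrow> memory \<Rightarrow> bool) \<Rightarrow> bool" where
  "polytime p Q \<longleftrightarrow>
     (\<exists>r c :: nat poly. \<forall>s M. bounded_by M s \<longrightarrow>
        (\<exists>t s'. exec p s t s' \<and> t \<le> poly c M \<and> bounded_by (M + poly r (s 0 0)) s' \<and>
                s' 0 = s 0 \<and> Q s s'))"

lemma polytimeI:
  fixes r c :: "nat poly"
  assumes "\<And>s M. bounded_by M s \<Longrightarrow>
    \<exists>t s'. exec p s t s' \<and> t \<le> poly c M \<and> bounded_by (M + poly r (s 0 0)) s' \<and>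
           s' 0 = s 0 \<and> Q s s'"
  shows "polytime p Q"
  using assms unfolding polytime_def by blast

lemma polytime_weaken:
  assumes "polytime p Q" "\<And>s s'. s' 0 = s 0 \<Longrightarrow> Q s s' \<Longrightarrow> Q' s s'"
  shows "polytime p Q'"
proof -
  from assms(1) obtain r c :: "nat poly" where rc: "\<And>s M. bounded_by M s \<Longrightarrow>
    \<exists>t s'. exec p s t s' \<and> t \<le> poly c M \<and> bounded_by (M + poly r (s 0 0)) s' \<and> s' 0 = s 0 \<and> Q s s'"
    unfolding polytime_def by blast
  show ?thesis
    by (rule polytimeI[of _ c r]) (use rc assms(2) in blast)
qed

lemma polytime_Skip: "polytime Skip (\<lambda>s s'. s' = s)"
  by (rule polytimeI[of _ "[:1:]" 0]) (auto intro!: exI exec.Skip simp: bounded_by_def)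

text \<open>The increase \<open>d\<close> is a constant, which rules out storing a product or a sum
  of two cells. Array 0 is protected because it holds the input and the loop bound.\<close>

lemma polytime_Assign:
  assumes a: "a \<noteq> 0" and d: "\<And>s M. bounded_by M s \<Longrightarrow> val e2 s \<le> M + d"
  shows "polytime (Assign a e1 e2) (\<lambda>s s'. s' = s(a := (s a)(val e1 s := val e2 s)))"
proof -
  from expr_bound obtain q1 q2
    where q1: "\<And>s M. bounded_by M s \<Longrightarrow> cost e1 s \<le> poly q1 M"
      and q2: "\<And>s M. bounded_by M s \<Longrightarrow> cost e2 s \<le> poly q2 M" by meson
  show ?thesis
  proof (rule polytimeI[of _ "q1 + q2" "[:d:]"], intro exI conjI)
    fix s M assume b: "bounded_by M s"
    let ?s = "s(a := (s a)(val e1 s := val e2 s))"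
    show "exec (Assign a e1 e2) s (cost e1 s + cost e2 s) ?s" by (rule exec.Assign)
    show "cost e1 s + cost e2 s \<le> poly (q1 + q2) M" using q1[OF b] q2[OF b] by simp
    show "bounded_by (M + poly [:d:] (s 0 0)) ?s"
      using b d[OF b] by (auto simp: bounded_by_def intro: trans_le_add1)
  qed (use a in auto)
qed

text \<open>The second program starts from the bound \<open>M + poly r (s 0 0)\<close> with
  \<open>s 0 0 \<le> M\<close>, so its time bound is composed with \<open>[:0, 1:] + r\<close>. The
  increments simply add up, since \<open>s 0 0\<close> stays the same.\<close>

lemma polytime_Seq:
  assumes "polytime p P" "polytime q Q"
  shows "polytime (Seq p q) (P OO Q)"
proof -
  from assms(1) obtain r c :: "nat poly" where rc: "\<And>s M. bounded_by M s \<Longrightarrow>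
    \<exists>t s'. exec p s t s' \<and> t \<le> poly c M \<and> bounded_by (M + poly r (s 0 0)) s' \<and> s' 0 = s 0 \<and> P s s'"
    unfolding polytime_def by blast
  from assms(2) obtain r' c' :: "nat poly" where rc': "\<And>s M. bounded_by M s \<Longrightarrow>
    \<exists>t s'. exec q s t s' \<and> t \<le> poly c' M \<and> bounded_by (M + poly r' (s 0 0)) s' \<and> s' 0 = s 0 \<and> Q s s'"
    unfolding polytime_def by blast
  show ?thesis
  proof (rule polytimeI[of _ "c + pcompose c' ([:0, 1:] + r)" "r + r'"])
    fix s M assume b: "bounded_by M s"
    then obtain t s1 where 1: "exec p s t s1" "t \<le> poly c M"
      "bounded_by (M + poly r (s 0 0)) s1" "s1 0 = s 0" "P s s1" using rc by blast
    from rc'[OF 1(3)] obtain t' s2 where 2: "exec q s1 t' s2"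
      "t' \<le> poly c' (M + poly r (s 0 0))"
      "bounded_by (M + poly r (s 0 0) + poly r' (s 0 0)) s2" "s2 0 = s 0" "Q s1 s2"
      using 1(4) by auto
    have "s 0 0 \<le> M" using b by (simp add: bounded_by_def)
    then have "poly c' (M + poly r (s 0 0)) \<le> poly c' (M + poly r M)"
      by (intro poly_nat_mono add_mono order_refl)
    with 2(2) have "t' \<le> poly c' (M + poly r M)" by simp
    then show "\<exists>t s'. exec (Seq p q) s t s' \<and> t \<le> poly (c + pcompose c' ([:0, 1:] + r)) M \<and>
        bounded_by (M + poly (r + r') (s 0 0)) s' \<and> s' 0 = s 0 \<and> (P OO Q) s s'"
      using exec.Seq[OF 1(1) 2(1)] 1 2
      by (intro exI[of _ "t + t'"] exI[of _ s2]) (auto simp: poly_pcompose add.assoc)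
  qed
qed

lemma polytime_Cond:
  assumes "polytime p P" "polytime q Q"
  shows "polytime (Cond e p q) (\<lambda>s s'. if val e s \<noteq> 0 then P s s' else Q s s')"
proof -
  from assms(1) obtain r c :: "nat poly" where rc: "\<And>s M. bounded_by M s \<Longrightarrow>
    \<exists>t s'. exec p s t s' \<and> t \<le> poly c M \<and> bounded_by (M + poly r (s 0 0)) s' \<and> s' 0 = s 0 \<and> P s s'"
    unfolding polytime_def by blast
  from assms(2) obtain r' c' :: "nat poly" where rc': "\<And>s M. bounded_by M s \<Longrightarrow>
    \<exists>t s'. exec q s t s' \<and> t \<le> poly c' M \<and> bounded_by (M + poly r' (s 0 0)) s' \<and> s' 0 = s 0 \<and> Q s s'"
    unfolding polytime_def by blast
  from expr_bound obtain u where u: "\<And>s M. bounded_by M s \<Longrightarrow> cost e s \<le> poly u M" by meson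
  show ?thesis
  proof (rule polytimeI[of _ "u + c + c'" "r + r'"])
    fix s M assume b: "bounded_by M s"
    show "\<exists>t s'. exec (Cond e p q) s t s' \<and> t \<le> poly (u + c + c') M \<and>
        bounded_by (M + poly (r + r') (s 0 0)) s' \<and> s' 0 = s 0 \<and>
        (if val e s \<noteq> 0 then P s s' else Q s s')"
    proof (cases "val e s = 0")
      case True
      from rc'[OF b] obtain t s' where 1: "exec q s t s'" "t \<le> poly c' M"
        "bounded_by (M + poly r' (s 0 0)) s'" "s' 0 = s 0" "Q s s'" by blast
      show ?thesis
        using exec.CondFalse[OF True 1(1)] 1 True u[OF b]
        by (intro exI[of _ "cost e s + t"] exI[of _ s'])
           (auto elim: bounded_by_mono)
    next
      case False
      from rc[OF b] obtain t s' where 1: "exec p s t s'" "t \<le> poly c M"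
        "bounded_by (M + poly r (s 0 0)) s'" "s' 0 = s 0" "P s s'" by blast
      show ?thesis
        using exec.CondTrue[OF False 1(1)] 1 False u[OF b]
        by (intro exI[of _ "cost e s + t"] exI[of _ s'])
           (auto elim: bounded_by_mono)
    qed
  qed
qed

text \<open>Truncated subtraction turns the comparison of the counter with \<open>s 0 0\<close> into
  a test for nonzero.\<close>

abbreviation test_expr :: "nat \<Rightarrow> expr" where
  "test_expr i \<equiv> Minus (Cell 0 (Const 0)) (Cell i (Const 0))"

abbreviation incr :: "nat \<Rightarrow> program" where
  "incr i \<equiv> Assign i (Const 0) (Plus (Cell i (Const 0)) (Const 1))"

definition For :: "nat \<Rightarrow> program \<Rightarrow> program" where
  "For i p = Seq (Assign i (Const 0) (Const 0)) (While (test_expr i) (Seq p (incr i)))"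

abbreviation set_var :: "nat \<Rightarrow> nat \<Rightarrow> memory \<Rightarrow> memory" where
  "set_var i j s \<equiv> s(i := (s i)(0 := j))"

text \<open>Before round \<open>j\<close> all cells are at most \<open>M + j * poly r n\<close>,
  hence never above \<open>L\<close>. A round costs the body, the test (\<open>3 * L + 8\<close>)
  and the increment (\<open>2 * L + 8\<close>), which explains \<open>5 * L + 20\<close>; the
  summand \<open>3 * L + 20\<close> pays for the failing test. \<open>J j\<close> relates the memory
  \<open>s0\<close> before the loop to the one after \<open>j\<close> rounds.\<close>

lemma exec_loop:
  fixes r c :: "nat poly"
  assumes body: "\<And>s M. bounded_by M s \<Longrightarrow>
      \<exists>t s'. exec p s t s' \<and> t \<le> poly c M \<and> bounded_by (M + poly r (s 0 0)) s' \<and> s' 0 = s 0 \<and> Q s s'"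
    and frame: "\<And>s s'. Q s s' \<Longrightarrow> s' i = s i"
    and i: "i \<noteq> 0"
    and step: "\<And>j s s'. J j s0 s \<Longrightarrow> s i 0 = j \<Longrightarrow> j < s0 0 0 \<Longrightarrow> s 0 = s0 0 \<Longrightarrow> Q s s' \<Longrightarrow>
                 J (Suc j) s0 (set_var i (Suc j) s')"
    and n: "s0 0 0 = n" "n \<le> M"
    and L: "L = M + n * poly r n"
    and start: "j \<le> n" "s i 0 = j" "s 0 = s0 0" "J j s0 s" "bounded_by (M + j * poly r n) s"
  shows "\<exists>t s'. exec (While (test_expr i) (Seq p (incr i))) s t s' \<and>
           t \<le> (n - j) * (poly c L + 5 * L + 20) + 3 * L + 20 \<and>
           bounded_by L s' \<and> s' 0 = s0 0 \<and> J n s0 s'"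
  using start
proof (induction "n - j" arbitrary: j s)
  case 0
  then have j: "j = n" by simp
  have v: "val (test_expr i) s = 0" using 0 j n by simp
  have "cost (test_expr i) s \<le> 3 * L + 20"
    using bits_le[of 0] bits_le[of n] L n 0 j by simp
  then show ?case
    using exec.WhileFalse[OF v] 0 j L by (intro exI conjI) auto
next
  case (Suc d)
  have jn: "j < n" using Suc by simp
  have v: "val (test_expr i) s \<noteq> 0" using Suc jn n by simp
  from body[OF Suc.prems(5)] obtain t s1 where 1: "exec p s t s1"
    "t \<le> poly c (M + j * poly r n)" "bounded_by (M + j * poly r n + poly r n) s1" "s1 0 = s 0" "Q s s1"
    using n Suc.prems by auto
  have s1i: "s1 i 0 = j" using frame[OF 1(5)] Suc.prems by simp
  let ?s2 = "set_var i (Suc j) s1"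
  have inc: "exec (incr i) s1 (cost (Const 0) s1 + cost (Plus (Cell i (Const 0)) (Const 1)) s1) ?s2"
    using exec.Assign[of i "Const 0" "Plus (Cell i (Const 0)) (Const 1)" s1] s1i by simp
  have LM: "n \<le> L" using n L by simp
  \<comment> \<open>The counter becomes \<open>Suc j \<le> n \<le> M\<close>, so it needs no
    increase of the bound.\<close>
  have b2: "bounded_by (M + Suc j * poly r n) ?s2"
    using 1(3) jn n by (auto simp: bounded_by_def add_ac)
  have J2: "J (Suc j) s0 ?s2" using step[OF Suc.prems(4)] Suc.prems jn n 1(5) by simp
  have "\<exists>t s'. exec (While (test_expr i) (Seq p (incr i))) ?s2 t s' \<and>
           t \<le> (n - Suc j) * (poly c L + 5 * L + 20) + 3 * L + 20 \<and>
           bounded_by L s' \<and> s' 0 = s0 0 \<and> J n s0 s'"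
    by (rule Suc.hyps(1)) (use Suc.hyps(2) jn 1(4) Suc.prems(3) i J2 b2 in auto)
  then obtain t' s3 where 3: "exec (While (test_expr i) (Seq p (incr i))) ?s2 t' s3"
    "t' \<le> (n - Suc j) * (poly c L + 5 * L + 20) + 3 * L + 20"
    "bounded_by L s3" "s3 0 = s0 0" "J n s0 s3" by blast
  have "M + j * poly r n \<le> L" using L jn by (simp add: mult_right_mono)
  then have "poly c (M + j * poly r n) \<le> poly c L" by (rule poly_nat_mono)
  then have t: "t \<le> poly c L" using 1(2) by simp
  have c1: "cost (test_expr i) s \<le> 3 * L + 8"
    using bits_le[of 0] bits_le[of n] bits_le[of j] bits_le[of "n - j"] LM jn n Suc.prems by simp
  have c2: "cost (Const 0) s1 + cost (Plus (Cell i (Const 0)) (Const 1)) s1 \<le> 2 * L + 8"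
    using bits_le[of 0] bits_le[of 1] bits_le[of j] bits_le[of "Suc j"] LM jn s1i by simp
  have nj: "n - j = Suc (n - Suc j)" using jn by simp
  show ?case
    by (rule exI, rule exI, rule conjI, rule exec.WhileTrue[OF v exec.Seq[OF 1(1) inc] 3(1)])
       (use 3 c1 c2 t in \<open>simp add: nj\<close>)
qed

lemma polytime_For:
  assumes p: "polytime p Q"
    and frame: "\<And>s s'. Q s s' \<Longrightarrow> s' i = s i"
    and i: "i \<noteq> 0"
    and base: "\<And>s. J 0 s (set_var i 0 s)"
    and step: "\<And>j s0 s s'. J j s0 s \<Longrightarrow> s i 0 = j \<Longrightarrow> j < s0 0 0 \<Longrightarrow> s 0 = s0 0 \<Longrightarrow> Q s s' \<Longrightarrow>
                 J (Suc j) s0 (set_var i (Suc j) s')"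
  shows "polytime (For i p) (\<lambda>s s'. J (s 0 0) s s')"
proof -
  from p obtain r c :: "nat poly" where rc: "\<And>s M. bounded_by M s \<Longrightarrow>
    \<exists>t s'. exec p s t s' \<and> t \<le> poly c M \<and> bounded_by (M + poly r (s 0 0)) s' \<and> s' 0 = s 0 \<and> Q s s'"
    unfolding polytime_def by blast
  \<comment> \<open>\<open>l\<close> bounds \<open>L\<close> by a polynomial in \<open>M\<close>,
    because the number of rounds \<open>s 0 0\<close> is itself at most \<open>M\<close>.\<close>
  define l where "l = [:0, 1:] + [:0, 1:] * r"
  show ?thesis
  proof (rule polytimeI[of _ "[:0, 1:] * (pcompose c l + 5 * l + [:20:]) + 3 * l + [:30:]" "[:0, 1:] * r"])
    fix s M assume b: "bounded_by M s"
    let ?n = "s 0 0" and ?s = "set_var i 0 s"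
    let ?L = "M + ?n * poly r ?n"
    have nM: "?n \<le> M" using b by (simp add: bounded_by_def)
    have 1: "exec (Assign i (Const 0) (Const 0)) s (cost (Const 0) s + cost (Const 0) s) ?s"
      using exec.Assign[of i "Const 0" "Const 0" s] by simp
    have "\<exists>t s'. exec (While (test_expr i) (Seq p (incr i))) ?s t s' \<and>
           t \<le> (?n - 0) * (poly c ?L + 5 * ?L + 20) + 3 * ?L + 20 \<and>
           bounded_by ?L s' \<and> s' 0 = s 0 \<and> J ?n s s'"
    proof (rule exec_loop[where p = p and Q = Q and r = r and c = c and M = M and J = J and i = i
          and ?s0.0 = s and s = ?s and n = ?n and j = 0 and L = ?L])
      show "J (Suc j) s (set_var i (Suc j) s'')"
        if "J j s s'" "s' i 0 = j" "j < s 0 0" "s' 0 = s 0" "Q s' s''" for j s' s''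
        using that by (rule step)
      show "bounded_by (M + 0 * poly r (s 0 0)) ?s" using b by (simp add: bounded_by_def)
    qed (use rc frame i base nM in \<open>blast | simp\<close>)+
    then obtain t s' where 2: "exec (While (test_expr i) (Seq p (incr i))) ?s t s'"
      "t \<le> ?n * (poly c ?L + 5 * ?L + 20) + 3 * ?L + 20"
      "bounded_by ?L s'" "s' 0 = s 0" "J ?n s s'" by auto
    have L: "?L \<le> poly l M"
      unfolding l_def by (simp add: mult_mono[OF nM poly_nat_mono[OF nM]])
    then have "?n * (poly c ?L + 5 * ?L + 20) \<le> M * (poly c (poly l M) + 5 * poly l M + 20)"
      by (intro mult_mono add_mono nM poly_nat_mono) auto
    then have t: "t \<le> M * (poly c (poly l M) + 5 * poly l M + 20) + 3 * poly l M + 20"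
      by (intro order_trans[OF 2(2)] add_mono mult_left_mono[OF L]) auto
    have "cost (Const 0) s + cost (Const 0) s \<le> 10" using bits_le[of 0] by simp
    then have tt: "cost (Const 0) s + cost (Const 0) s + t
        \<le> poly ([:0, 1:] * (pcompose c l + 5 * l + [:20:]) + 3 * l + [:30:]) M"
      using t by (simp add: poly_pcompose)
    show "\<exists>t s'. exec (For i p) s t s' \<and>
        t \<le> poly ([:0, 1:] * (pcompose c l + 5 * l + [:20:]) + 3 * l + [:30:]) M \<and>
        bounded_by (M + poly ([:0, 1:] * r) (s 0 0)) s' \<and> s' 0 = s 0 \<and> J (s 0 0) s s'"
      unfolding For_def
      by - (rule exI, rule exI, rule conjI, rule exec.Seq[OF 1 2(1)], use 2 tt in auto)
  qed
qed

section \<open>Compilation of counting terms\<close>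

text \<open>Counting is the only binder; a bounded existential quantifier is a nonzero count.
  Variables are de Bruijn indices, \<open>Inp\<close> reads the input and \<open>Mem\<close> the
  marks.\<close>

datatype tm =
    Var nat
  | Num nat
  | Inp tm
  | Mem tm
  | Add tm tm
  | Sub tm tm
  | Mul tm tm
  | Count tm

definition push :: "'a \<Rightarrow> (nat \<Rightarrow> 'a) \<Rightarrow> nat \<Rightarrow> 'a" where
  "push a \<rho> i = (case i of 0 \<Rightarrow> a | Suc j \<Rightarrow> \<rho> j)"

lemma push_0 [simp]: "push a \<rho> 0 = a"
  and push_Suc [simp]: "push a \<rho> (Suc i) = \<rho> i"
  by (simp_all add: push_def)

fun sem :: "(nat \<Rightarrow> nat) \<Rightarrow> (nat \<Rightarrow> nat) \<Rightarrow> (nat \<Rightarrow> nat) \<Rightarrow> tm \<Rightarrow> nat" where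
  "sem x m \<rho> (Var i) = \<rho> i"
| "sem x m \<rho> (Num c) = c"
| "sem x m \<rho> (Inp t) = x (sem x m \<rho> t)"
| "sem x m \<rho> (Mem t) = m (sem x m \<rho> t)"
| "sem x m \<rho> (Add t u) = sem x m \<rho> t + sem x m \<rho> u"
| "sem x m \<rho> (Sub t u) = sem x m \<rho> t - sem x m \<rho> u"
| "sem x m \<rho> (Mul t u) = sem x m \<rho> t * sem x m \<rho> u"
| "sem x m \<rho> (Count t) = card {j. j < x 0 \<and> sem x m (push j \<rho>) t \<noteq> 0}"

text \<open>This is the number of scratch arrays: every \<open>Count\<close> takes one for its
  counter and one for its tally.\<close>

fun width :: "tm \<Rightarrow> nat" where
  "width (Var i) = 0"
| "width (Num c) = 0"
| "width (Inp t) = width t"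
| "width (Mem t) = width t"
| "width (Add t u) = width t + width u"
| "width (Sub t u) = width t + width u"
| "width (Mul t u) = width t + width u"
| "width (Count t) = 2 + width t"

text \<open>
  \<open>\<Gamma>\<close> maps variables to the arrays that hold them in cell 0, and the arrays from \<open>k\<close> on are free.
  A term is split into a program that evaluates its counting subterms and an expression that
  reads their values; so products only occur in expressions and are never stored.
\<close>

fun tm_expr :: "(nat \<Rightarrow> nat) \<Rightarrow> nat \<Rightarrow> tm \<Rightarrow> expr" where
  "tm_expr \<Gamma> k (Var i) = Cell (\<Gamma> i) (Const 0)"
| "tm_expr \<Gamma> k (Num c) = Const c"
| "tm_expr \<Gamma> k (Inp t) = Cell 0 (tm_expr \<Gamma> k t)"
| "tm_expr \<Gamma> k (Mem t) = Cell 1 (tm_expr \<Gamma> k t)"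
| "tm_expr \<Gamma> k (Add t u) = Plus (tm_expr \<Gamma> k t) (tm_expr \<Gamma> (k + width t) u)"
| "tm_expr \<Gamma> k (Sub t u) = Minus (tm_expr \<Gamma> k t) (tm_expr \<Gamma> (k + width t) u)"
| "tm_expr \<Gamma> k (Mul t u) = Times (tm_expr \<Gamma> k t) (tm_expr \<Gamma> (k + width t) u)"
| "tm_expr \<Gamma> k (Count t) = Cell (k + 1) (Const 0)"

fun tm_prog :: "(nat \<Rightarrow> nat) \<Rightarrow> nat \<Rightarrow> tm \<Rightarrow> program" where
  "tm_prog \<Gamma> k (Var i) = Skip"
| "tm_prog \<Gamma> k (Num c) = Skip"
| "tm_prog \<Gamma> k (Inp t) = tm_prog \<Gamma> k t"
| "tm_prog \<Gamma> k (Mem t) = tm_prog \<Gamma> k t"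
| "tm_prog \<Gamma> k (Add t u) = Seq (tm_prog \<Gamma> k t) (tm_prog \<Gamma> (k + width t) u)"
| "tm_prog \<Gamma> k (Sub t u) = Seq (tm_prog \<Gamma> k t) (tm_prog \<Gamma> (k + width t) u)"
| "tm_prog \<Gamma> k (Mul t u) = Seq (tm_prog \<Gamma> k t) (tm_prog \<Gamma> (k + width t) u)"
| "tm_prog \<Gamma> k (Count t) =
     Seq (Assign (k + 1) (Const 0) (Const 0))
       (For k (Seq (tm_prog (push k \<Gamma>) (k + 2) t)
         (Cond (tm_expr (push k \<Gamma>) (k + 2) t) (incr (k + 1)) Skip)))"

lemma polytime_incr:
  "i \<noteq> 0 \<Longrightarrow> polytime (incr i) (\<lambda>s s'. s' = set_var i (Suc (s i 0)) s)"
  by (rule polytime_weaken[OF polytime_Assign[where d = 1]]) (auto simp: bounded_by_def)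

lemma polytime_set_const:
  "i \<noteq> 0 \<Longrightarrow> polytime (Assign i e (Const c)) (\<lambda>s s'. s' = s(i := (s i)(val e s := c)))"
  by (rule polytime_weaken[OF polytime_Assign[where d = c]]) (auto simp: bounded_by_def)

lemma push_less: "\<forall>i. \<Gamma> i < k \<Longrightarrow> k < k' \<Longrightarrow> push k \<Gamma> i < k'" for k k' :: nat
  by (cases i) (auto intro: less_trans)

text \<open>No array from \<open>k + width t\<close> on is read, so the value of a term survives the
  program of a term compiled after it. By \<open>2 \<le> k\<close>, the arrays 0 and 1 of
  \<open>Inp\<close> and \<open>Mem\<close> lie below that limit.\<close>

lemma val_tm_expr_cong:
  assumes "2 \<le> k" "\<forall>i. \<Gamma> i < k" "\<And>a. a < k + width t \<Longrightarrow> s a = s' a"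
  shows "val (tm_expr \<Gamma> k t) s = val (tm_expr \<Gamma> k t) s'"
  using assms
proof (induction t arbitrary: k)
  case (Var i)
  then show ?case by simp
next
  case (Add t u)
  have "val (tm_expr \<Gamma> k t) s = val (tm_expr \<Gamma> k t) s'"
    by (rule Add.IH) (use Add.prems in auto)
  moreover have "val (tm_expr \<Gamma> (k + width t) u) s = val (tm_expr \<Gamma> (k + width t) u) s'"
    by (rule Add.IH) (use Add.prems in \<open>auto intro: trans_less_add1\<close>)
  ultimately show ?case by simp
next
  case (Sub t u)
  have "val (tm_expr \<Gamma> k t) s = val (tm_expr \<Gamma> k t) s'"
    by (rule Sub.IH) (use Sub.prems in auto)
  moreover have "val (tm_expr \<Gamma> (k + width t) u) s = val (tm_expr \<Gamma> (k + width t) u) s'"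
    by (rule Sub.IH) (use Sub.prems in \<open>auto intro: trans_less_add1\<close>)
  ultimately show ?case by simp
next
  case (Mul t u)
  have "val (tm_expr \<Gamma> k t) s = val (tm_expr \<Gamma> k t) s'"
    by (rule Mul.IH) (use Mul.prems in auto)
  moreover have "val (tm_expr \<Gamma> (k + width t) u) s = val (tm_expr \<Gamma> (k + width t) u) s'"
    by (rule Mul.IH) (use Mul.prems in \<open>auto intro: trans_less_add1\<close>)
  ultimately show ?case by simp
next
  case (Inp t)
  then have "val (tm_expr \<Gamma> k t) s = val (tm_expr \<Gamma> k t) s'" by simp
  with Inp.prems show ?case by simp
next
  case (Mem t)
  then have "val (tm_expr \<Gamma> k t) s = val (tm_expr \<Gamma> k t) s'" by simp
  with Mem.prems show ?case by simp
qed auto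

definition tm_spec :: "(nat \<Rightarrow> nat) \<Rightarrow> nat \<Rightarrow> tm \<Rightarrow> memory \<Rightarrow> memory \<Rightarrow> bool" where
  "tm_spec \<Gamma> k t s s' \<longleftrightarrow>
     (\<forall>a. a < k \<or> k + width t \<le> a \<longrightarrow> s' a = s a) \<and>
     val (tm_expr \<Gamma> k t) s' = sem (s 0) (s 1) (\<lambda>i. s (\<Gamma> i) 0) t"

lemma tm_spec_Seq:
  assumes "tm_spec \<Gamma> k t s s1" "tm_spec \<Gamma> (k + width t) u s1 s2" "2 \<le> k" "\<forall>i. \<Gamma> i < k"
  shows "\<forall>a. a < k \<or> k + width t + width u \<le> a \<longrightarrow> s2 a = s a"
    and "val (tm_expr \<Gamma> k t) s2 = sem (s 0) (s 1) (\<lambda>i. s (\<Gamma> i) 0) t"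
    and "val (tm_expr \<Gamma> (k + width t) u) s2 = sem (s 0) (s 1) (\<lambda>i. s (\<Gamma> i) 0) u"
proof -
  have 1: "s1 a = s a" if "a < k" for a using assms that by (simp add: tm_spec_def)
  show "\<forall>a. a < k \<or> k + width t + width u \<le> a \<longrightarrow> s2 a = s a"
    using assms by (auto simp: tm_spec_def)
  have "val (tm_expr \<Gamma> k t) s2 = val (tm_expr \<Gamma> k t) s1"
    by (rule val_tm_expr_cong) (use assms in \<open>auto simp: tm_spec_def\<close>)
  then show "val (tm_expr \<Gamma> k t) s2 = sem (s 0) (s 1) (\<lambda>i. s (\<Gamma> i) 0) t"
    using assms by (simp add: tm_spec_def)
  show "val (tm_expr \<Gamma> (k + width t) u) s2 = sem (s 0) (s 1) (\<lambda>i. s (\<Gamma> i) 0) u"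
    using assms 1 by (simp add: tm_spec_def)
qed

lemma polytime_tm_prog_Seq:
  assumes "polytime (tm_prog \<Gamma> k t) (tm_spec \<Gamma> k t)"
    and "polytime (tm_prog \<Gamma> (k + width t) u) (tm_spec \<Gamma> (k + width t) u)"
    and "2 \<le> k" "\<forall>i. \<Gamma> i < k"
  shows "polytime (Seq (tm_prog \<Gamma> k t) (tm_prog \<Gamma> (k + width t) u)) (\<lambda>s s'.
     (\<forall>a. a < k \<or> k + width t + width u \<le> a \<longrightarrow> s' a = s a) \<and>
     val (tm_expr \<Gamma> k t) s' = sem (s 0) (s 1) (\<lambda>i. s (\<Gamma> i) 0) t \<and>
     val (tm_expr \<Gamma> (k + width t) u) s' = sem (s 0) (s 1) (\<lambda>i. s (\<Gamma> i) 0) u)"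
  using tm_spec_Seq[OF _ _ assms(3,4)]
  by (intro polytime_weaken[OF polytime_Seq[OF assms(1,2)]] conjI) (blast elim: relcomppE)+

lemma card_less_Suc_conj:
  "card {i. i < Suc j \<and> P i} = card {i. i < j \<and> P i} + (if P j then 1 else 0)"
proof -
  have "{i. i < Suc j \<and> P i} = {i. i < j \<and> P i} \<union> (if P j then {j} else {})"
    by (auto simp: less_Suc_eq)
  then show ?thesis by (auto simp: card_insert_if)
qed

lemma polytime_tm_prog:
  assumes "2 \<le> k" "\<forall>i. \<Gamma> i < k"
  shows "polytime (tm_prog \<Gamma> k t) (tm_spec \<Gamma> k t)"
  using assms
proof (induction t arbitrary: \<Gamma> k)
  case (Var i)
  show ?case
    by (simp, rule polytime_weaken[OF polytime_Skip]) (simp add: tm_spec_def)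
next
  case (Num c)
  show ?case
    by (simp, rule polytime_weaken[OF polytime_Skip]) (simp add: tm_spec_def)
next
  case (Inp t)
  show ?case
    unfolding tm_prog.simps
    by (rule polytime_weaken[OF Inp.IH[OF Inp.prems]]) (auto simp: tm_spec_def)
next
  case (Mem t)
  show ?case
    unfolding tm_prog.simps
    by (rule polytime_weaken[OF Mem.IH[OF Mem.prems]]) (use Mem.prems in \<open>auto simp: tm_spec_def\<close>)
next
  case (Add t u)
  have "polytime (tm_prog \<Gamma> (k + width t) u) (tm_spec \<Gamma> (k + width t) u)"
    by (rule Add.IH) (use Add.prems in \<open>auto intro: trans_less_add1\<close>)
  note polytime_tm_prog_Seq[OF Add.IH(1)[OF Add.prems] this Add.prems]
  then show ?case
    unfolding tm_prog.simps by (rule polytime_weaken) (auto simp: tm_spec_def add.assoc)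
next
  case (Sub t u)
  have "polytime (tm_prog \<Gamma> (k + width t) u) (tm_spec \<Gamma> (k + width t) u)"
    by (rule Sub.IH) (use Sub.prems in \<open>auto intro: trans_less_add1\<close>)
  note polytime_tm_prog_Seq[OF Sub.IH(1)[OF Sub.prems] this Sub.prems]
  then show ?case
    unfolding tm_prog.simps by (rule polytime_weaken) (auto simp: tm_spec_def add.assoc)
next
  case (Mul t u)
  have "polytime (tm_prog \<Gamma> (k + width t) u) (tm_spec \<Gamma> (k + width t) u)"
    by (rule Mul.IH) (use Mul.prems in \<open>auto intro: trans_less_add1\<close>)
  note polytime_tm_prog_Seq[OF Mul.IH(1)[OF Mul.prems] this Mul.prems]
  then show ?case
    unfolding tm_prog.simps by (rule polytime_weaken) (auto simp: tm_spec_def add.assoc)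
next
  case (Count t)
  let ?G = "push k \<Gamma>"
  let ?P = "\<lambda>s i. sem (s 0) (s 1) (push i (\<lambda>i. s (\<Gamma> i) 0)) t \<noteq> 0"
  \<comment> \<open>The tally is counted on top of its value at the start, which is set to 0 before
    the loop. \<open>?J\<close> leaves out array \<open>k\<close>, which the loop increments;
    \<open>?Q\<close> includes it, since the body must not touch the counter.\<close>
  let ?J = "\<lambda>j s s'. (\<forall>a. a < k \<or> k + width (Count t) \<le> a \<longrightarrow> s' a = s a) \<and>
               s' (k + 1) 0 = s (k + 1) 0 + card {i. i < j \<and> ?P s i}"
  let ?Q = "\<lambda>s s'. (\<forall>a. a \<le> k \<or> k + width (Count t) \<le> a \<longrightarrow> s' a = s a) \<and>
               s' (k + 1) 0 = s (k + 1) 0 + (if ?P s (s k 0) then 1 else 0)"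
  have G: "\<forall>i. ?G i < k + 2" using Count.prems push_less[of \<Gamma> k "k + 2"] by simp
  \<comment> \<open>Inside the loop the counter is the new variable 0.\<close>
  have env: "(\<lambda>i. s (?G i) 0) = push (s k 0) (\<lambda>i. s (\<Gamma> i) 0)" for s :: memory
    by (auto simp: push_def split: nat.splits)
  have 1: "polytime (tm_prog ?G (k + 2) t) (tm_spec ?G (k + 2) t)"
    by (rule Count.IH) (use Count.prems G in auto)
  have 2: "polytime (Cond (tm_expr ?G (k + 2) t) (incr (k + 1)) Skip)
     (\<lambda>s s'. if val (tm_expr ?G (k + 2) t) s \<noteq> 0 then s' = set_var (k + 1) (Suc (s (k + 1) 0)) s else s' = s)"
    by (intro polytime_Cond polytime_incr polytime_Skip) simp
  have 3: "polytime (Seq (tm_prog ?G (k + 2) t) (Cond (tm_expr ?G (k + 2) t) (incr (k + 1)) Skip)) ?Q"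
  proof (rule polytime_weaken[OF polytime_Seq[OF 1 2]])
    fix s s'
    assume "(tm_spec ?G (k + 2) t OO
      (\<lambda>s s'. if val (tm_expr ?G (k + 2) t) s \<noteq> 0 then s' = set_var (k + 1) (Suc (s (k + 1) 0)) s else s' = s)) s s'"
    then obtain s1 where A: "tm_spec ?G (k + 2) t s s1"
      and B: "if val (tm_expr ?G (k + 2) t) s1 \<noteq> 0 then s' = set_var (k + 1) (Suc (s1 (k + 1) 0)) s1 else s' = s1"
      by blast
    from A have "val (tm_expr ?G (k + 2) t) s1 \<noteq> 0 \<longleftrightarrow> ?P s (s k 0)"
      and f: "\<forall>a. a < k + 2 \<or> k + 2 + width t \<le> a \<longrightarrow> s1 a = s a"
      by (simp_all add: tm_spec_def env)
    with B have s': "s' = (if ?P s (s k 0) then set_var (k + 1) (Suc (s1 (k + 1) 0)) s1 else s1)" by presburger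
    show "?Q s s'" unfolding s' using f by simp
  qed
  have 4: "polytime (For k (Seq (tm_prog ?G (k + 2) t) (Cond (tm_expr ?G (k + 2) t) (incr (k + 1)) Skip)))
     (\<lambda>s s'. ?J (s 0 0) s s')"
  proof (rule polytime_For[where J = ?J, OF 3])
    fix j and s0 s s' :: memory
    assume J: "?J j s0 s" and j: "s k 0 = j" and Q: "?Q s s'"
    have "s 0 = s0 0" "s 1 = s0 1" "(\<lambda>i. s (\<Gamma> i) 0) = (\<lambda>i. s0 (\<Gamma> i) 0)"
      using J Count.prems by auto
    then have "?P s i \<longleftrightarrow> ?P s0 i" for i by simp
    then show "?J (Suc j) s0 (set_var k (Suc j) s')"
      using J Q j by (auto simp: card_less_Suc_conj)
  qed (use Count.prems in auto)
  have 5: "polytime (Assign (k + 1) (Const 0) (Const 0)) (\<lambda>s s'. s' = set_var (k + 1) 0 s)"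
    by (rule polytime_weaken[OF polytime_set_const]) auto
  \<comment> \<open>Clearing the tally does not affect the variables, which live below
    \<open>k\<close>.\<close>
  have cong: "(\<lambda>i. set_var (k + 1) 0 s (\<Gamma> i) 0) = (\<lambda>i. s (\<Gamma> i) 0)" for s :: memory
    using Count.prems(2) by (auto simp: fun_eq_iff) (metis less_SucI less_irrefl)
  show ?case
    unfolding tm_prog.simps
    by (rule polytime_weaken[OF polytime_Seq[OF 5 4]])
       (use Count.prems in \<open>auto simp: tm_spec_def cong[simplified] elim!: relcomppE\<close>)
qed

section \<open>Commands that set marks in array 1\<close>

datatype cmd =
    Mark tm tm
  | Loop cmd
  | Then cmd cmd

definition mark :: "bool \<Rightarrow> nat \<Rightarrow> (nat \<Rightarrow> nat) \<Rightarrow> nat \<Rightarrow> nat" where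
  "mark P i m = (if P then m(i := 1) else m)"

fun csem :: "(nat \<Rightarrow> nat) \<Rightarrow> (nat \<Rightarrow> nat) \<Rightarrow> cmd \<Rightarrow> (nat \<Rightarrow> nat) \<Rightarrow> nat \<Rightarrow> nat" where
  "csem x \<rho> (Mark t u) m = mark (sem x m \<rho> t \<noteq> 0) (sem x m \<rho> u) m"
| "csem x \<rho> (Loop c) m = fold (\<lambda>j. csem x (push j \<rho>) c) [0..<x 0] m"
| "csem x \<rho> (Then c d) m = csem x \<rho> d (csem x \<rho> c m)"

fun cmd_prog :: "(nat \<Rightarrow> nat) \<Rightarrow> nat \<Rightarrow> cmd \<Rightarrow> program" where
  "cmd_prog \<Gamma> k (Mark t u) =
     Seq (Seq (tm_prog \<Gamma> k t) (tm_prog \<Gamma> (k + width t) u))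
       (Cond (tm_expr \<Gamma> k t) (Assign 1 (tm_expr \<Gamma> (k + width t) u) (Const 1)) Skip)"
| "cmd_prog \<Gamma> k (Loop c) = For k (cmd_prog (push k \<Gamma>) (k + 1) c)"
| "cmd_prog \<Gamma> k (Then c d) = Seq (cmd_prog \<Gamma> k c) (cmd_prog \<Gamma> k d)"

text \<open>Only the constant 1 is ever stored as a mark, so the restriction on growth is met
  whatever the address is. Variables must avoid array 1, because marks are set while the loop
  counters are in use.\<close>

lemma polytime_cmd_prog:
  assumes "2 \<le> k" "\<forall>i. \<Gamma> i < k \<and> \<Gamma> i \<noteq> 1"
  shows "polytime (cmd_prog \<Gamma> k c) (\<lambda>s s'.
     (\<forall>a<k. a \<noteq> 1 \<longrightarrow> s' a = s a) \<and> s' 1 = csem (s 0) (\<lambda>i. s (\<Gamma> i) 0) c (s 1))"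
  using assms
proof (induction c arbitrary: \<Gamma> k)
  case (Mark t u)
  have 1: "polytime (tm_prog \<Gamma> k t) (tm_spec \<Gamma> k t)"
    by (rule polytime_tm_prog) (use Mark.prems in auto)
  have 2: "polytime (tm_prog \<Gamma> (k + width t) u) (tm_spec \<Gamma> (k + width t) u)"
    by (rule polytime_tm_prog) (use Mark.prems in \<open>auto intro: trans_less_add1\<close>)
  have 3: "polytime (Cond (tm_expr \<Gamma> k t) (Assign 1 (tm_expr \<Gamma> (k + width t) u) (Const 1)) Skip)
     (\<lambda>s s'. if val (tm_expr \<Gamma> k t) s \<noteq> 0
             then s' = s(1 := (s 1)(val (tm_expr \<Gamma> (k + width t) u) s := 1)) else s' = s)"
    by (intro polytime_Cond polytime_set_const polytime_Skip) simp
  have k: "\<forall>i. \<Gamma> i < k" using Mark.prems by simp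
  show ?case
    unfolding cmd_prog.simps
  proof (rule polytime_weaken[OF polytime_Seq[OF polytime_tm_prog_Seq[OF 1 2 Mark.prems(1) k] 3]])
    fix s s'
    assume "((\<lambda>s s'. (\<forall>a. a < k \<or> k + width t + width u \<le> a \<longrightarrow> s' a = s a) \<and>
        val (tm_expr \<Gamma> k t) s' = sem (s 0) (s 1) (\<lambda>i. s (\<Gamma> i) 0) t \<and>
        val (tm_expr \<Gamma> (k + width t) u) s' = sem (s 0) (s 1) (\<lambda>i. s (\<Gamma> i) 0) u) OO
      (\<lambda>s s'. if val (tm_expr \<Gamma> k t) s \<noteq> 0
             then s' = s(1 := (s 1)(val (tm_expr \<Gamma> (k + width t) u) s := 1)) else s' = s)) s s'"
    then obtain s1 where
      A: "(\<forall>a. a < k \<or> k + width t + width u \<le> a \<longrightarrow> s1 a = s a) \<and>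
        val (tm_expr \<Gamma> k t) s1 = sem (s 0) (s 1) (\<lambda>i. s (\<Gamma> i) 0) t \<and>
        val (tm_expr \<Gamma> (k + width t) u) s1 = sem (s 0) (s 1) (\<lambda>i. s (\<Gamma> i) 0) u"
      and B: "if val (tm_expr \<Gamma> k t) s1 \<noteq> 0
        then s' = s1(1 := (s1 1)(val (tm_expr \<Gamma> (k + width t) u) s1 := 1)) else s' = s1"
      by blast
    let ?t = "sem (s 0) (s 1) (\<lambda>i. s (\<Gamma> i) 0) t" and ?u = "sem (s 0) (s 1) (\<lambda>i. s (\<Gamma> i) 0) u"
    from A B have "s' = (if ?t \<noteq> 0 then s1(1 := (s1 1)(?u := 1)) else s1)" by presburger
    then show "(\<forall>a<k. a \<noteq> 1 \<longrightarrow> s' a = s a) \<and>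
        s' 1 = csem (s 0) (\<lambda>i. s (\<Gamma> i) 0) (Mark t u) (s 1)"
      using A Mark.prems(1) by (simp add: mark_def)
  qed
next
  case (Loop c)
  let ?G = "push k \<Gamma>"
  have G: "\<forall>i. ?G i < k + 1 \<and> ?G i \<noteq> 1"
    using Loop.prems by (auto simp: push_def less_Suc_eq split: nat.splits)
  have env: "(\<lambda>i. s (?G i) 0) = push (s k 0) (\<lambda>i. s (\<Gamma> i) 0)" for s :: memory
    by (auto simp: push_def split: nat.splits)
  let ?J = "\<lambda>j s s'. (\<forall>a<k. a \<noteq> 1 \<longrightarrow> s' a = s a) \<and>
     s' 1 = fold (\<lambda>j. csem (s 0) (push j (\<lambda>i. s (\<Gamma> i) 0)) c) [0..<j] (s 1)"
  have 1: "polytime (cmd_prog ?G (k + 1) c) (\<lambda>s s'.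
     (\<forall>a<k + 1. a \<noteq> 1 \<longrightarrow> s' a = s a) \<and> s' 1 = csem (s 0) (\<lambda>i. s (?G i) 0) c (s 1))"
    by (rule Loop.IH) (use Loop.prems G in auto)
  have "polytime (For k (cmd_prog ?G (k + 1) c)) (\<lambda>s s'. ?J (s 0 0) s s')"
  proof (rule polytime_For[where J = ?J, OF 1])
    fix j and s0 s s' :: memory
    assume J: "?J j s0 s" and j: "s k 0 = j" "s 0 = s0 0"
      and Q: "(\<forall>a<k + 1. a \<noteq> 1 \<longrightarrow> s' a = s a) \<and> s' 1 = csem (s 0) (\<lambda>i. s (?G i) 0) c (s 1)"
    have "(\<lambda>i. s (\<Gamma> i) 0) = (\<lambda>i. s0 (\<Gamma> i) 0)" using J Loop.prems by auto
    then show "?J (Suc j) s0 (set_var k (Suc j) s')"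
      using J Q j Loop.prems by (simp add: env)
  qed (use Loop.prems in auto)
  then show ?case by simp
next
  case (Then c d)
  show ?case
    unfolding cmd_prog.simps
  proof (rule polytime_weaken[OF polytime_Seq[OF Then.IH(1)[OF Then.prems] Then.IH(2)[OF Then.prems]]],
      elim relcomppE conjE)
    fix s s' s1 :: memory
    assume 1: "\<forall>a<k. a \<noteq> 1 \<longrightarrow> s1 a = s a" "s1 1 = csem (s 0) (\<lambda>i. s (\<Gamma> i) 0) c (s 1)"
      and 2: "\<forall>a<k. a \<noteq> 1 \<longrightarrow> s' a = s1 a" "s' 1 = csem (s1 0) (\<lambda>i. s1 (\<Gamma> i) 0) d (s1 1)"
    have "(\<lambda>i. s1 (\<Gamma> i) 0) = (\<lambda>i. s (\<Gamma> i) 0)" "s1 0 = s 0"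
      using 1(1) Then.prems by auto
    then show "(\<forall>a<k. a \<noteq> 1 \<longrightarrow> s' a = s a) \<and>
        s' 1 = csem (s 0) (\<lambda>i. s (\<Gamma> i) 0) (Then c d) (s 1)"
      using 1 2 by simp
  qed
qed

section \<open>Closure properties of definable functions and decidable predicates\<close>

definition definable :: "((nat \<Rightarrow> nat) \<Rightarrow> (nat \<Rightarrow> nat) \<Rightarrow> (nat \<Rightarrow> nat) \<Rightarrow> nat) \<Rightarrow> bool" where
  "definable f \<longleftrightarrow> (\<exists>t. \<forall>x m \<rho>. sem x m \<rho> t = f x m \<rho>)"

lemma definable_const: "definable (\<lambda>x m \<rho>. c)"
  unfolding definable_def by (rule exI[of _ "Num c"]) simp

lemma definable_var: "definable (\<lambda>x m \<rho>. \<rho> i)"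
  unfolding definable_def by (rule exI[of _ "Var i"]) simp

lemma definable_inp: "definable f \<Longrightarrow> definable (\<lambda>x m \<rho>. x (f x m \<rho>))"
  unfolding definable_def by (metis sem.simps(3))

lemma definable_mem: "definable f \<Longrightarrow> definable (\<lambda>x m \<rho>. m (f x m \<rho>))"
  unfolding definable_def by (metis sem.simps(4))

lemma definable_add: "definable f \<Longrightarrow> definable g \<Longrightarrow> definable (\<lambda>x m \<rho>. f x m \<rho> + g x m \<rho>)"
  unfolding definable_def by (metis sem.simps(5))

lemma definable_diff: "definable f \<Longrightarrow> definable g \<Longrightarrow> definable (\<lambda>x m \<rho>. f x m \<rho> - g x m \<rho>)"
  unfolding definable_def by (metis sem.simps(6))

lemma definable_mult: "definable f \<Longrightarrow> definable g \<Longrightarrow> definable (\<lambda>x m \<rho>. f x m \<rho> * g x m \<rho>)"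
  unfolding definable_def by (metis sem.simps(7))

definition decidable :: "((nat \<Rightarrow> nat) \<Rightarrow> (nat \<Rightarrow> nat) \<Rightarrow> (nat \<Rightarrow> nat) \<Rightarrow> bool) \<Rightarrow> bool" where
  "decidable P \<longleftrightarrow> (\<exists>t. \<forall>x m \<rho>. sem x m \<rho> t \<noteq> 0 \<longleftrightarrow> P x m \<rho>)"

text \<open>
  The premise binds the counted variable as variable 0 and shifts the other ones; all these rules
  are meant to be applied backwards by higher-order pattern unification.
\<close>

lemma definable_card:
  assumes "decidable (\<lambda>x m \<rho>. P x m (\<lambda>i. \<rho> (Suc i)) (\<rho> 0))"
  shows "definable (\<lambda>x m \<rho>. card {j. j < x 0 \<and> P x m \<rho> j})"
proof -
  from assms obtain t where "\<And>x m \<rho>. sem x m \<rho> t \<noteq> 0 \<longleftrightarrow> P x m (\<lambda>i. \<rho> (Suc i)) (\<rho> 0)"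
    unfolding decidable_def by blast
  then have "sem x m \<rho> (Count t) = card {j. j < x 0 \<and> P x m \<rho> j}" for x m \<rho> by simp
  then show ?thesis unfolding definable_def by blast
qed

lemma decidable_nonzero: "definable f \<Longrightarrow> decidable (\<lambda>x m \<rho>. f x m \<rho> \<noteq> 0)"
  unfolding definable_def decidable_def by metis

lemma decidable_cong: "decidable Q \<Longrightarrow> (\<And>x m \<rho>. P x m \<rho> \<longleftrightarrow> Q x m \<rho>) \<Longrightarrow> decidable P"
  unfolding decidable_def by metis

lemma decidable_less:
  "definable f \<Longrightarrow> definable g \<Longrightarrow> decidable (\<lambda>x m \<rho>. f x m \<rho> < g x m \<rho>)"
  by (rule decidable_cong[where Q = "\<lambda>x m \<rho>. g x m \<rho> - f x m \<rho> \<noteq> 0"],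
      rule decidable_nonzero, rule definable_diff) auto

lemma decidable_conj:
  assumes "decidable P" "decidable Q"
  shows "decidable (\<lambda>x m \<rho>. P x m \<rho> \<and> Q x m \<rho>)"
proof -
  from assms obtain t u where "\<And>x m \<rho>. sem x m \<rho> t \<noteq> 0 \<longleftrightarrow> P x m \<rho>" "\<And>x m \<rho>. sem x m \<rho> u \<noteq> 0 \<longleftrightarrow> Q x m \<rho>"
    unfolding decidable_def by blast
  then have "sem x m \<rho> (Mul t u) \<noteq> 0 \<longleftrightarrow> P x m \<rho> \<and> Q x m \<rho>" for x m \<rho> by simp
  then show ?thesis unfolding decidable_def by blast
qed

lemma decidable_not:
  assumes "decidable P"
  shows "decidable (\<lambda>x m \<rho>. \<not> P x m \<rho>)"
proof -
  from assms obtain t where t: "\<And>x m \<rho>. sem x m \<rho> t \<noteq> 0 \<longleftrightarrow> P x m \<rho>"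
    unfolding decidable_def by blast
  have "sem x m \<rho> (Sub (Num 1) t) \<noteq> 0 \<longleftrightarrow> \<not> P x m \<rho>" for x m \<rho> using t[of x m \<rho>] by auto
  then show ?thesis unfolding decidable_def by blast
qed

lemma decidable_disj: "decidable P \<Longrightarrow> decidable Q \<Longrightarrow> decidable (\<lambda>x m \<rho>. P x m \<rho> \<or> Q x m \<rho>)"
  by (rule decidable_cong[OF decidable_not[OF decidable_conj[OF decidable_not decidable_not]]]) auto

lemma decidable_imp: "decidable P \<Longrightarrow> decidable Q \<Longrightarrow> decidable (\<lambda>x m \<rho>. P x m \<rho> \<longrightarrow> Q x m \<rho>)"
  by (rule decidable_cong[OF decidable_disj[OF decidable_not]]) auto

lemma decidable_eq:
  assumes "definable f" "definable g"
  shows "decidable (\<lambda>x m \<rho>. f x m \<rho> = g x m \<rho>)"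
proof (rule decidable_cong)
  show "decidable (\<lambda>x m \<rho>. \<not> f x m \<rho> < g x m \<rho> \<and> \<not> g x m \<rho> < f x m \<rho>)"
    by (intro decidable_conj decidable_not decidable_less assms)
qed auto

lemma decidable_ex:
  assumes "decidable (\<lambda>x m \<rho>. P x m (\<lambda>i. \<rho> (Suc i)) (\<rho> 0))"
  shows "decidable (\<lambda>x m \<rho>. \<exists>j < x 0. P x m \<rho> j)"
  using decidable_nonzero[OF definable_card[OF assms]] by (rule decidable_cong) auto

lemma decidable_all:
  assumes "decidable (\<lambda>x m \<rho>. P x m (\<lambda>i. \<rho> (Suc i)) (\<rho> 0))"
  shows "decidable (\<lambda>x m \<rho>. \<forall>j < x 0. P x m \<rho> j)"
  using decidable_not[OF decidable_ex[OF decidable_not[OF assms]]] by (rule decidable_cong) auto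

text \<open>With these rules the term for the algorithm is never written down: its existence is read
  off the mathematical definitions, which therefore bound every quantifier and every cardinality by
  \<open>n\<close>.\<close>

lemmas definable_intros =
  definable_const definable_var definable_inp definable_mem definable_add definable_mult definable_card
  decidable_less decidable_eq decidable_not decidable_conj decidable_disj decidable_imp
  decidable_ex decidable_all

definition computable_update ::
    "((nat \<Rightarrow> nat) \<Rightarrow> (nat \<Rightarrow> nat) \<Rightarrow> (nat \<Rightarrow> nat) \<Rightarrow> nat \<Rightarrow> nat) \<Rightarrow> bool" where
  "computable_update f \<longleftrightarrow> (\<exists>c. \<forall>x \<rho> m. csem x \<rho> c m = f x \<rho> m)"

lemma computable_mark:
  assumes "decidable (\<lambda>x m \<rho>. P x \<rho> m)" "definable (\<lambda>x m \<rho>. f x \<rho> m)"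
  shows "computable_update (\<lambda>x \<rho> m. mark (P x \<rho> m) (f x \<rho> m) m)"
proof -
  from assms obtain t u where "\<And>x m \<rho>. sem x m \<rho> t \<noteq> 0 \<longleftrightarrow> P x \<rho> m" "\<And>x m \<rho>. sem x m \<rho> u = f x \<rho> m"
    unfolding decidable_def definable_def by blast
  then have "csem x \<rho> (Mark t u) m = mark (P x \<rho> m) (f x \<rho> m) m" for x \<rho> m by simp
  then show ?thesis unfolding computable_update_def by blast
qed

lemma computable_for:
  assumes "computable_update (\<lambda>x \<rho>. f x (\<lambda>i. \<rho> (Suc i)) (\<rho> 0))"
  shows "computable_update (\<lambda>x \<rho>. fold (\<lambda>j. f x \<rho> j) [0..<x 0])"
proof -
  from assms obtain c where "\<And>x \<rho> m. csem x \<rho> c m = f x (\<lambda>i. \<rho> (Suc i)) (\<rho> 0) m"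
    unfolding computable_update_def by blast
  then have "csem x (push j \<rho>) c = f x \<rho> j" for x \<rho> j by (simp add: fun_eq_iff)
  then have "csem x \<rho> (Loop c) m = fold (\<lambda>j. f x \<rho> j) [0..<x 0] m" for x \<rho> m by simp
  then show ?thesis unfolding computable_update_def by blast
qed

lemma computable_comp:
  assumes "computable_update f" "computable_update g"
  shows "computable_update (\<lambda>x \<rho> m. g x \<rho> (f x \<rho> m))"
proof -
  from assms obtain c d where "\<And>x \<rho> m. csem x \<rho> c m = f x \<rho> m" "\<And>x \<rho> m. csem x \<rho> d m = g x \<rho> m"
    unfolding computable_update_def by blast
  then have "csem x \<rho> (Then c d) m = g x \<rho> (f x \<rho> m)" for x \<rho> m by simp
  then show ?thesis unfolding computable_update_def by blast
qed

theorem polytime_decision: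
  assumes "computable_update f"
  obtains p where "polytime p (\<lambda>s s'. s' 1 = f (s 0) (\<lambda>_. s 2 0) (s 1))"
proof -
  from assms obtain c where c: "\<And>x \<rho> m. csem x \<rho> c m = f x \<rho> m"
    unfolding computable_update_def by blast
  show thesis
    \<comment> \<open>All free variables are sent to array 2, and the scratch arrays start at
      3.\<close>
    by (rule that, rule polytime_weaken[OF polytime_cmd_prog[where \<Gamma> = "\<lambda>_. 2" and k = 3 and c = c]])
       (auto simp: c)
qed

section \<open>Reduction to 2-SAT\<close>

text \<open>Because of \<open>u \<noteq> v\<close> this also makes sense for \<open>a = b\<close>,
  where it says that the class is a clique.\<close>

definition complete_between where
  "complete_between n adj col a b \<longleftrightarrow>
     (\<forall>u<n. \<forall>v<n. col u = a \<and> col v = b \<and> u \<noteq> v \<longrightarrow> adj u v)"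
  for n :: nat and adj :: "nat \<Rightarrow> nat \<Rightarrow> bool" and col :: "nat \<Rightarrow> nat" and a b :: nat

definition empty_between where
  "empty_between n adj col a b \<longleftrightarrow>
     (\<forall>u<n. \<forall>v<n. col u = a \<and> col v = b \<and> u \<noteq> v \<longrightarrow> \<not> adj u v)"
  for n :: nat and adj :: "nat \<Rightarrow> nat \<Rightarrow> bool" and col :: "nat \<Rightarrow> nat" and a b :: nat

text \<open>
  Adjacency of two positions under the decoder that is forced on the pairs of classes with all or
  no edges between them and that contains the pair of letters \<open>(a, b)\<close> iff \<open>P a b\<close> otherwise.
\<close>

definition joined where
  "joined n adj col w P i j \<longleftrightarrow> i \<noteq> j \<and>
     (complete_between n adj col (w i) (w j) \<or>
      \<not> empty_between n adj col (w i) (w j) \<and> (i < j \<and> P (w i) (w j) \<or> j < i \<and> P (w j) (w i)))"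
  for n :: nat and adj :: "nat \<Rightarrow> nat \<Rightarrow> bool" and col w :: "nat \<Rightarrow> nat" and P :: "nat \<Rightarrow> nat \<Rightarrow> bool" and i j :: nat

definition vertex_deg where
  "vertex_deg n adj col v b = card {u. u < n \<and> (col u = b \<and> adj v u)}"
  for n :: nat and adj :: "nat \<Rightarrow> nat \<Rightarrow> bool" and col :: "nat \<Rightarrow> nat" and v b :: nat

definition pos_deg where
  "pos_deg n adj col w P i b = card {j. j < n \<and> (w j = b \<and> joined n adj col w P i j)}"
  for n :: nat and adj :: "nat \<Rightarrow> nat \<Rightarrow> bool" and col w :: "nat \<Rightarrow> nat" and P :: "nat \<Rightarrow> nat \<Rightarrow> bool" and i b :: nat

text \<open>Degrees are below \<open>n\<close>, so trying all \<open>p, q < n\<close> compares the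
  whole multisets of pairs. \<open>P\<close> and \<open>Q\<close> are separate because the two
  degrees depend on different choices.\<close>

definition clash where
  "clash n adj col w e b P c Q \<longleftrightarrow>
     (\<exists>p<n. \<exists>q<n.
        card {v. v < n \<and> (col v = e \<and> vertex_deg n adj col v b = p \<and> vertex_deg n adj col v c = q)} \<noteq>
        card {i. i < n \<and> (w i = e \<and> pos_deg n adj col w P i b = p \<and> pos_deg n adj col w Q i c = q)})"
  for n :: nat and adj :: "nat \<Rightarrow> nat \<Rightarrow> bool" and col w :: "nat \<Rightarrow> nat" and e b c :: nat
    and P Q :: "nat \<Rightarrow> nat \<Rightarrow> bool"

text \<open>
  A literal \<open>(x, y)\<close> with \<open>x \<noteq> y\<close> says that the decoder contains \<open>(x, y)\<close>, but not \<open>(y, x)\<close>;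
  so negation is \<open>prod.swap\<close>. It fixes the degrees of the positions of either letter into the other.
\<close>

definition conflict where
  "conflict n adj col w x y x' y' \<longleftrightarrow>
     (\<exists>e<n. \<exists>b<n. \<exists>c<n.
        (e = x \<and> b = y \<or> e = y \<and> b = x) \<and> (e = x' \<and> c = y' \<or> e = y' \<and> c = x') \<and>
        clash n adj col w e b (\<lambda>k l. k = x \<and> l = y) c (\<lambda>k l. k = x' \<and> l = y'))"
  for n :: nat and adj :: "nat \<Rightarrow> nat \<Rightarrow> bool" and col w :: "nat \<Rightarrow> nat" and x y x' y' :: nat

definition homogeneous where
  "homogeneous n adj col \<longleftrightarrow>
     (\<forall>a<n. complete_between n adj col a a \<or> empty_between n adj col a a)"
  for n :: nat and adj :: "nat \<Rightarrow> nat \<Rightarrow> bool" and col :: "nat \<Rightarrow> nat"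

text \<open>The literal \<open>(d, c)\<close> is the negation of \<open>(c, d)\<close>; so a
  conflict of \<open>(a, b)\<close> with it is a clause, read as an implication.\<close>

definition implications :: "nat \<Rightarrow> (nat \<Rightarrow> nat \<Rightarrow> bool) \<Rightarrow> (nat \<Rightarrow> nat) \<Rightarrow> (nat \<Rightarrow> nat) \<Rightarrow>
    ((nat \<times> nat) \<times> (nat \<times> nat)) set" where
  "implications n adj col w =
     {((a, b), (c, d)) | a b c d. a < n \<and> b < n \<and> c < n \<and> d < n \<and>
        (a \<noteq> b \<and> c \<noteq> d \<and> conflict n adj col w a b d c)}"

definition satisfiable where
  "satisfiable n adj col w \<longleftrightarrow>
     homogeneous n adj col \<and>
     (\<forall>a<n. \<forall>b<n. \<not> (((a, b), (b, a)) \<in> (implications n adj col w)\<^sup>+ \<and>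
                      ((b, a), (a, b)) \<in> (implications n adj col w)\<^sup>+))"
  for n :: nat and adj :: "nat \<Rightarrow> nat \<Rightarrow> bool" and col w :: "nat \<Rightarrow> nat"

section \<open>2-SAT, uniqueness of threshold graphs, and simultaneous sorting\<close>

lemma two_sat:
  fixes neg :: "'l \<Rightarrow> 'l"
  assumes fin: "finite L" and neg: "\<And>l. neg (neg l) = l" "\<And>l. l \<in> L \<Longrightarrow> neg l \<in> L"
    and R: "R \<subseteq> L \<times> L" and skew: "\<And>l m. (l, m) \<in> R \<Longrightarrow> (neg m, neg l) \<in> R"
    and irr: "\<And>l. l \<in> L \<Longrightarrow> neg l \<noteq> l"
    and nocycle: "\<And>l. l \<in> L \<Longrightarrow> \<not> ((l, neg l) \<in> R\<^sup>+ \<and> (neg l, l) \<in> R\<^sup>+)"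
  shows "\<exists>S\<subseteq>L. (\<forall>l\<in>L. l \<in> S \<longleftrightarrow> neg l \<notin> S) \<and> R `` S \<subseteq> S"
proof -
  \<comment> \<open>A consistent closed set of maximum size decides every literal: otherwise it
    could be enlarged by all that some undecided literal reaches.\<close>
  define good where "good S \<longleftrightarrow> S \<subseteq> L \<and> R `` S \<subseteq> S \<and> (\<forall>l\<in>S. neg l \<notin> S)" for S
  have rskew: "(neg m, neg l) \<in> R\<^sup>*" if "(l, m) \<in> R\<^sup>*" for l m
    using that by induction (auto dest: skew intro: converse_rtrancl_into_rtrancl)
  have closed: "m \<in> S" if "(l, m) \<in> R\<^sup>*" "l \<in> S" "good S" for l m S
    using that by induction (auto simp: good_def)
  have "finite {S. good S}"
    by (rule finite_subset[of _ "Pow L"]) (auto simp: good_def fin)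
  moreover have "good {}" by (simp add: good_def)
  ultimately obtain S where S: "good S" and max: "\<And>S'. good S' \<Longrightarrow> card S' \<le> card S"
    using obtains_MAX[of "{S. good S}" card] by (metis (mono_tags) empty_iff mem_Collect_eq
        Max_ge finite_imageI imageI)
  have finS: "finite S" using S fin by (auto simp: good_def dest: finite_subset)
  have "l \<in> S \<or> neg l \<in> S" if l: "l \<in> L" for l
  proof (rule ccontr)
    assume no: "\<not> (l \<in> S \<or> neg l \<in> S)"
    \<comment> \<open>One of \<open>l\<close> and \<open>neg l\<close> does not reach its own
      negation, and that one can safely be made true.\<close>
    from nocycle[OF l] obtain x where x: "x = l \<or> x = neg l" "(x, neg x) \<notin> R\<^sup>+"
      using neg(1) by metis
    have xL: "x \<in> L" and xS: "x \<notin> S" "neg x \<notin> S" using x no l neg by auto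
    have xr: "(x, neg x) \<notin> R\<^sup>*" using x(2) irr[OF xL] by (metis rtranclD)
    let ?S = "S \<union> R\<^sup>* `` {x}"
    have sub: "R\<^sup>* `` {x} \<subseteq> L"
    proof
      fix y assume "y \<in> R\<^sup>* `` {x}"
      then have "(x, y) \<in> R\<^sup>*" by simp
      then show "y \<in> L" by induction (use xL R in auto)
    qed
    \<comment> \<open>From \<open>neg y\<close> the contraposition \<open>rskew\<close> leads on to
      \<open>neg x\<close>. So if \<open>neg y\<close> were reachable too, \<open>x\<close> would
      reach its negation; if it were in the closed set \<open>S\<close>, so would be
      \<open>neg x\<close>.\<close>
    have cons: "neg y \<notin> R\<^sup>* `` {x}" "neg y \<notin> S" if "(x, y) \<in> R\<^sup>*" for y
    proof -
      have y: "(neg y, neg x) \<in> R\<^sup>*" using rskew[OF that] .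
      show "neg y \<notin> R\<^sup>* `` {x}" using y xr by (auto dest: rtrancl_trans)
      show "neg y \<notin> S" using closed[OF y _ S] xS by blast
    qed
    have "good ?S"
      unfolding good_def
    proof (intro conjI ballI)
      show "?S \<subseteq> L" using sub S by (auto simp: good_def)
      show "R `` ?S \<subseteq> ?S" using S by (auto simp: good_def intro: rtrancl_into_rtrancl)
      fix y assume "y \<in> ?S"
      then show "neg y \<notin> ?S"
        using cons[of y] cons[of "neg y"] S by (auto simp: good_def neg(1))
    qed
    moreover have "card S < card ?S"
      using xS sub fin finS by (intro psubset_card_mono) (auto dest: finite_subset)
    ultimately show False using max[of ?S] by simp
  qed
  then show ?thesis using S by (intro exI[of _ S]) (auto simp: good_def)
qed

text \<open>
  Among all bipartite graphs, \<open>F\<close> is the unique one that maximizes the sum of the weights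
  \<open>g v + h u\<close> of the edges; but that sum is determined by the degrees.
\<close>

lemma threshold_graph_unique:
  fixes g :: "'a \<Rightarrow> int" and h :: "'b \<Rightarrow> int"
  assumes fin: "finite A" "finite B"
    and F: "\<And>v u. v \<in> A \<Longrightarrow> u \<in> B \<Longrightarrow> F v u \<longleftrightarrow> g v + h u > 0"
    and nz: "\<And>v u. v \<in> A \<Longrightarrow> u \<in> B \<Longrightarrow> g v + h u \<noteq> 0"
    and row: "\<And>v. v \<in> A \<Longrightarrow> card {u \<in> B. E v u} = card {u \<in> B. F v u}"
    and col: "\<And>u. u \<in> B \<Longrightarrow> card {v \<in> A. E v u} = card {v \<in> A. F v u}"
    and v: "v \<in> A" and u: "u \<in> B"
  shows "E v u \<longleftrightarrow> F v u"
proof -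
  \<comment> \<open>The rows and columns of \<open>d\<close> sum to 0, hence so does its weighted
    sum. As \<open>F\<close> consists of exactly the edges of positive weight, no summand is
    negative, and all of them vanish.\<close>
  define d :: "'a \<Rightarrow> 'b \<Rightarrow> int" where "d v u = of_bool (F v u) - of_bool (E v u)" for v u
  have row0: "(\<Sum>u\<in>B. d v u) = 0" if "v \<in> A" for v
    using row[OF that] fin by (simp add: d_def sum_subtractf sum_of_bool_eq Int_def)
  have col0: "(\<Sum>v\<in>A. d v u) = 0" if "u \<in> B" for u
    using col[OF that] fin by (simp add: d_def sum_subtractf sum_of_bool_eq Int_def)
  have "(\<Sum>v\<in>A. \<Sum>u\<in>B. d v u * (g v + h u)) =
      (\<Sum>v\<in>A. g v * (\<Sum>u\<in>B. d v u)) + (\<Sum>u\<in>B. h u * (\<Sum>v\<in>A. d v u))"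
    by (simp add: distrib_left sum.distrib sum_distrib_left sum.swap[of _ B A] mult.commute)
  also have "\<dots> = 0" by (simp add: row0 col0)
  finally have sum0: "(\<Sum>v\<in>A. \<Sum>u\<in>B. d v u * (g v + h u)) = 0" .
  have nonneg: "d v u * (g v + h u) \<ge> 0" if "v \<in> A" "u \<in> B" for v u
    using F[OF that] by (auto simp: d_def)
  have "(\<Sum>u\<in>B. d v u * (g v + h u)) = 0"
    using sum0 v fin by (subst (asm) sum_nonneg_eq_0_iff) (auto intro!: sum_nonneg nonneg)
  then have "d v u * (g v + h u) = 0"
    using u v fin by (subst (asm) sum_nonneg_eq_0_iff) (auto intro!: nonneg)
  then show ?thesis using nz[OF v u] by (auto simp: d_def of_bool_def split: if_splits)
qed

lemma image_mset_eqI: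
  assumes "finite V" "finite W" "\<And>p. card {v \<in> V. f v = p} = card {i \<in> W. g i = p}"
  shows "image_mset f (mset_set V) = image_mset g (mset_set W)"
proof (rule multiset_eqI)
  fix p
  have "count (image_mset f (mset_set V)) p = card {v \<in> V. f v = p}"
    using assms(1) by (simp add: count_image_mset Int_def vimage_def conj_commute)
  moreover have "count (image_mset g (mset_set W)) p = card {i \<in> W. g i = p}"
    using assms(2) by (simp add: count_image_mset Int_def vimage_def conj_commute)
  ultimately show "count (image_mset f (mset_set V)) p = count (image_mset g (mset_set W)) p"
    using assms(3) by simp
qed

text \<open>
  The vectors \<open>Y i\<close> are linearly ordered by the componentwise order, up to the signs of the
  components. Agreement on all pairs of components forces the same on the vectors \<open>X v\<close>.
\<close>

lemma matching_from_pairs: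
  fixes X Y :: "nat \<Rightarrow> 'b \<Rightarrow> nat"
  assumes fin: "finite V" "finite W" "finite B" and card: "card V = card W"
    and mono: "\<And>b. b \<in> B \<Longrightarrow> (\<forall>i\<in>W. \<forall>j\<in>W. i \<le> j \<longrightarrow> Y i b \<le> Y j b) \<or>
                              (\<forall>i\<in>W. \<forall>j\<in>W. i \<le> j \<longrightarrow> Y j b \<le> Y i b)"
    and pairs: "\<And>b c p q. b \<in> B \<Longrightarrow> c \<in> B \<Longrightarrow>
      card {v \<in> V. X v b = p \<and> X v c = q} = card {i \<in> W. Y i b = p \<and> Y i c = q}"
  shows "\<exists>f. bij_betw f V W \<and> (\<forall>v\<in>V. \<forall>b\<in>B. X v b = Y (f v) b)"
proof -
  define up where "up b \<longleftrightarrow> (\<forall>i\<in>W. \<forall>j\<in>W. i \<le> j \<longrightarrow> Y i b \<le> Y j b)" for b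
  \<comment> \<open>The sign reverses the decreasing components, so that all of them increase along
    \<open>W\<close>.\<close>
  define s where "s b x = (if up b then int x else - int x)" for b x
  have s_inj: "s b x = s b y \<longleftrightarrow> x = y" for b x y by (simp add: s_def)
  have s_mono: "s b (Y i b) \<le> s b (Y j b)" if "b \<in> B" "i \<in> W" "j \<in> W" "i \<le> j" for b i j
    using mono[OF that(1)] that by (auto simp: s_def up_def)
  \<comment> \<open>The pairs of values of \<open>u\<close> and \<open>v\<close> in the components
    \<open>b\<close> and \<open>c\<close> occur at some positions \<open>i\<close> and
    \<open>j\<close>. Component \<open>b\<close> reveals that \<open>i < j\<close>, and monotonicity
    carries this over to \<open>c\<close>.\<close>
  have same_order: "s c (X u c) \<le> s c (X v c)"
    if b: "b \<in> B" and c: "c \<in> B" and u: "u \<in> V" and v: "v \<in> V" and lt: "s b (X u b) < s b (X v b)"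
    for b c u v
  proof -
    have ex: "\<exists>i\<in>W. Y i b = X v b \<and> Y i c = X v c" if "v \<in> V" for v
    proof -
      have "card {v' \<in> V. X v' b = X v b \<and> X v' c = X v c} \<noteq> 0" using that fin by auto
      then have "{i \<in> W. Y i b = X v b \<and> Y i c = X v c} \<noteq> {}"
        unfolding pairs[OF b c] by (metis card.empty)
      then show ?thesis by blast
    qed
    from ex[OF u] obtain i where i: "i \<in> W" "Y i b = X u b" "Y i c = X u c" by blast
    from ex[OF v] obtain j where j: "j \<in> W" "Y j b = X v b" "Y j c = X v c" by blast
    have "\<not> j \<le> i" using s_mono[OF b j(1) i(1)] lt i j by auto
    then show ?thesis using s_mono[OF c i(1) j(1)] i j by simp
  qed
  \<comment> \<open>By \<open>same_order\<close>, two components never disagree strictly, so sorting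
    by their sum sorts all of them at once.\<close>
  define S where "S v = (\<Sum>b\<in>B. s b (X v b))" for v
  have S_mono: "s b (X u b) \<le> s b (X v b)" if "S u \<le> S v" "u \<in> V" "v \<in> V" "b \<in> B" for u v b
  proof (rule ccontr)
    assume "\<not> s b (X u b) \<le> s b (X v b)"
    then have lt: "s b (X v b) < s b (X u b)" by simp
    have "S v < S u"
      unfolding S_def
      by (rule sum_strict_mono_ex1) (use fin lt that same_order[OF that(4) _ that(3,2) lt] in auto)
    then show False using that by simp
  qed
  define vs where "vs = sort_key S (sorted_list_of_set V)"
  define ws where "ws = sorted_list_of_set W"
  define m where "m = card V"
  have vs: "set vs = V" "distinct vs" "length vs = m"
    using fin by (simp_all add: vs_def m_def)
  have ws: "set ws = W" "distinct ws" "length ws = m" "sorted ws"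
    using fin card by (simp_all add: ws_def m_def)
  have mset: "mset vs = mset_set V" "mset ws = mset_set W"
    using mset_set_set[OF vs(2)] mset_set_set[OF ws(2)] vs ws by simp_all
  \<comment> \<open>In each component both lists are sorted and have the same multiset of values, so
    they are equal; thus matching by rank is right for all components.\<close>
  have eq: "map (\<lambda>v. s b (X v b)) vs = map (\<lambda>i. s b (Y i b)) ws" if b: "b \<in> B" for b
  proof -
    have "sorted (map S vs)" by (simp add: vs_def)
    then have "sorted (map (\<lambda>v. s b (X v b)) vs)"
      using vs(1) b by (auto simp: sorted_map intro!: S_mono elim!: sorted_wrt_mono_rel[rotated])
    moreover have "sorted (map (\<lambda>i. s b (Y i b)) ws)"
      using ws(1,4) b by (auto simp: sorted_map intro!: s_mono elim!: sorted_wrt_mono_rel[rotated])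
    moreover have "mset (map (\<lambda>v. s b (X v b)) vs) = mset (map (\<lambda>i. s b (Y i b)) ws)"
    proof -
      have "image_mset (\<lambda>v. X v b) (mset_set V) = image_mset (\<lambda>i. Y i b) (mset_set W)"
      proof (intro image_mset_eqI fin)
        \<comment> \<open>The diagonal case \<open>c = b\<close> of the assumption gives the
          distribution of a single component.\<close>
        show "card {v \<in> V. X v b = p} = card {i \<in> W. Y i b = p}" for p
          using pairs[OF b b, of p p] by simp
      qed
      from arg_cong[OF this, of "image_mset (s b)"] show ?thesis
        by (simp add: mset multiset.map_comp comp_def)
    qed
    ultimately show ?thesis by (metis properties_for_sort)
  qed
  have bv: "bij_betw (nth vs) {..<m} V" using bij_betw_nth[of vs "{..<m}" V] vs by simp
  have bw: "bij_betw (nth ws) {..<m} W" using bij_betw_nth[of ws "{..<m}" W] ws by simp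
  let ?f = "nth ws \<circ> inv_into {..<m} (nth vs)"
  have "bij_betw ?f V W" by (rule bij_betw_trans[OF bij_betw_inv_into[OF bv] bw])
  moreover have "X v b = Y (?f v) b" if v: "v \<in> V" and b: "b \<in> B" for v b
  proof -
    let ?k = "inv_into {..<m} (nth vs) v"
    have k: "?k < m" "vs ! ?k = v"
      using v bv by (metis bij_betw_def inv_into_into lessThan_iff) (metis bij_betw_inv_into_right bv v)
    have "map (\<lambda>v. s b (X v b)) vs ! ?k = map (\<lambda>i. s b (Y i b)) ws ! ?k" using eq[OF b] by simp
    then show ?thesis using k vs(3) ws(3) by (simp add: s_inj)
  qed
  ultimately show ?thesis by blast
qed

section \<open>Decoders versus orientations of the pairs of letters\<close>

definition realizable where
  "realizable n adj col w \<longleftrightarrow> (\<exists>D f. bij_betw f {..<n} {..<n} \<and> (\<forall>v<n. w (f v) = col v) \<and>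
     (\<forall>u<n. \<forall>v<n. f u < f v \<longrightarrow> (adj u v \<longleftrightarrow> (col u, col v) \<in> D)))"
  for n :: nat and adj :: "nat \<Rightarrow> nat \<Rightarrow> bool" and col w :: "nat \<Rightarrow> nat"

locale colored_graph =
  fixes n :: nat and adj :: "nat \<Rightarrow> nat \<Rightarrow> bool" and col w :: "nat \<Rightarrow> nat"
  assumes adj_sym: "u < n \<Longrightarrow> v < n \<Longrightarrow> adj u v \<longleftrightarrow> adj v u"
    and adj_irrefl: "v < n \<Longrightarrow> \<not> adj v v"
    and col_less: "v < n \<Longrightarrow> col v < n"
    and card_class: "card {v. v < n \<and> col v = a} = card {i. i < n \<and> w i = a}"
begin

abbreviation "compl \<equiv> complete_between n adj col"
abbreviation "empt \<equiv> empty_between n adj col"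
abbreviation "join \<equiv> joined n adj col w"
abbreviation "vdeg \<equiv> vertex_deg n adj col"
abbreviation "pdeg \<equiv> pos_deg n adj col w"

text \<open>These are the truth assignments of the 2-SAT instance, \<open>P a b\<close> being the
  value of the literal \<open>(a, b)\<close>.\<close>

definition orientation :: "(nat \<Rightarrow> nat \<Rightarrow> bool) \<Rightarrow> bool" where
  "orientation P \<longleftrightarrow> (\<forall>a<n. \<forall>b<n. a \<noteq> b \<longrightarrow> (P a b \<longleftrightarrow> \<not> P b a))"

lemma compl_sym: "compl a b \<longleftrightarrow> compl b a"
  and empt_sym: "empt a b \<longleftrightarrow> empt b a"
  unfolding complete_between_def empty_between_def using adj_sym by metis+

lemma join_sym: "join P i j \<longleftrightarrow> join P j i"
  unfolding joined_def using compl_sym empt_sym by blast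

lemma clash_sym: "clash n adj col w e b P c Q \<longleftrightarrow> clash n adj col w e c Q b P"
proof -
  have 1: "clash n adj col w e b P c Q" if "clash n adj col w e c Q b P" for b c P Q
    using that unfolding clash_def by (auto simp: conj_ac)
  show ?thesis using 1 by blast
qed

lemma conflict_sym: "conflict n adj col w x y x' y' \<longleftrightarrow> conflict n adj col w x' y' x y"
  unfolding conflict_def using clash_sym by blast

text \<open>Degrees from one of the letters \<open>x\<close> and \<open>y\<close> into the other
  consult the choice only at \<open>(x, y)\<close> and \<open>(y, x)\<close>, where \<open>P\<close>
  and the single literal agree.\<close>

lemma pdeg_literal:
  assumes "orientation P" "P x y" "x < n" "y < n" "x \<noteq> y"
    and "e = x \<and> b = y \<or> e = y \<and> b = x" "w i = e"
  shows "pdeg (\<lambda>k l. k = x \<and> l = y) i b = pdeg P i b"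
proof -
  have "\<not> P y x" using assms unfolding orientation_def by blast
  then have "join (\<lambda>k l. k = x \<and> l = y) i j \<longleftrightarrow> join P i j" if "w j = b" for j
    using assms that unfolding joined_def by auto
  then have "w j = b \<and> join (\<lambda>k l. k = x \<and> l = y) i j \<longleftrightarrow> w j = b \<and> join P i j" for j by blast
  then show ?thesis unfolding pos_deg_def by simp
qed

text \<open>This replaces the two separate literals in \<open>conflict\<close> by one assignment
  that makes both true.\<close>

lemma conflict_orientation:
  assumes P: "orientation P" and xy: "P x y" "x < n" "y < n" "x \<noteq> y"
    and xy': "P x' y'" "x' < n" "y' < n" "x' \<noteq> y'"
  shows "conflict n adj col w x y x' y' \<longleftrightarrow>
     (\<exists>e<n. \<exists>b<n. \<exists>c<n.
        (e = x \<and> b = y \<or> e = y \<and> b = x) \<and> (e = x' \<and> c = y' \<or> e = y' \<and> c = x') \<and>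
        clash n adj col w e b P c P)"
proof -
  have "clash n adj col w e b (\<lambda>k l. k = x \<and> l = y) c (\<lambda>k l. k = x' \<and> l = y') \<longleftrightarrow>
        clash n adj col w e b P c P"
    if 1: "e = x \<and> b = y \<or> e = y \<and> b = x" and 2: "e = x' \<and> c = y' \<or> e = y' \<and> c = x'" for e b c
    unfolding clash_def
    using pdeg_literal[OF P xy 1] pdeg_literal[OF P xy' 2] by (simp cong: conj_cong)
  then have "(e = x \<and> b = y \<or> e = y \<and> b = x) \<and> (e = x' \<and> c = y' \<or> e = y' \<and> c = x') \<and>
        clash n adj col w e b (\<lambda>k l. k = x \<and> l = y) c (\<lambda>k l. k = x' \<and> l = y') \<longleftrightarrow>
      (e = x \<and> b = y \<or> e = y \<and> b = x) \<and> (e = x' \<and> c = y' \<or> e = y' \<and> c = x') \<and>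
        clash n adj col w e b P c P" for e b c by blast
  then show ?thesis unfolding conflict_def by simp
qed

lemma realizable_imp_satisfiable:
  assumes "realizable n adj col w"
  shows "satisfiable n adj col w"
proof -
  from assms obtain D f where bij: "bij_betw f {..<n} {..<n}" and wf: "\<And>v. v < n \<Longrightarrow> w (f v) = col v"
    and D: "\<And>u v. u < n \<Longrightarrow> v < n \<Longrightarrow> f u < f v \<Longrightarrow> adj u v \<longleftrightarrow> (col u, col v) \<in> D"
    unfolding realizable_def by blast
  have neq: "f u \<noteq> f v" if "u < n" "v < n" "u \<noteq> v" for u v
    using bij that by (auto simp: bij_betw_def inj_on_def)
  have f_less: "f u < n" if "u < n" for u using bij that by (auto simp: bij_betw_def)
  have f_surj: "\<exists>u<n. f u = j" if "j < n" for j
    using bij that by (metis bij_betw_def imageE lessThan_iff)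
  have hom: "homogeneous n adj col"
    unfolding homogeneous_def
  proof (intro allI impI)
    fix a
    have "adj u v \<longleftrightarrow> (a, a) \<in> D" if "u < n" "v < n" "u \<noteq> v" "col u = a" "col v = a" for u v
      using D[of u v] D[of v u] neq[of u v] adj_sym[of u v] that by (cases "f u < f v") auto
    then show "compl a a \<or> empt a a"
      unfolding complete_between_def empty_between_def by blast
  qed
  \<comment> \<open>If \<open>D\<close> contains both or neither of \<open>(a, b)\<close> and
    \<open>(b, a)\<close>, the order of the numbers breaks the tie. This is harmless: all or no
    edges then join the two classes, and \<open>joined\<close> does not depend on
    \<open>P\<close>.\<close>
  define P where "P a b \<longleftrightarrow> (if (a, b) \<in> D \<longleftrightarrow> (b, a) \<in> D then a < b else (a, b) \<in> D)" for a b
  have P: "orientation P" unfolding orientation_def P_def by auto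
  have join: "join P (f u) (f v) \<longleftrightarrow> adj u v" if u: "u < n" and v: "v < n" and ab: "col u \<noteq> col v" for u v
  proof -
    have uv: "u \<noteq> v" using ab by blast
    consider "compl (col u) (col v)" | "empt (col u) (col v)"
      | "\<not> compl (col u) (col v)" "\<not> empt (col u) (col v)" by blast
    then show ?thesis
    proof cases
      case 1
      then show ?thesis using u v uv neq wf unfolding joined_def complete_between_def by auto
    next
      case 2
      then have "\<not> adj u v" using u v uv unfolding empty_between_def by blast
      moreover from this have "\<not> compl (col u) (col v)"
        using u v uv unfolding complete_between_def by blast
      ultimately show ?thesis using 2 u v wf unfolding joined_def by simp
    next
      case 3
      have all: "adj u' v' \<longleftrightarrow> (if f u' < f v' then (col u, col v) \<in> D else (col v, col u) \<in> D)"
        if "u' < n" "v' < n" "col u' = col u" "col v' = col v" for u' v'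
      proof -
        have "u' \<noteq> v'" using that ab by auto
        then have "f u' < f v' \<or> f v' < f u'" using neq[of u' v'] that by linarith
        then show ?thesis
          using D[of u' v'] D[of v' u'] adj_sym[of u' v'] that by auto
      qed
      \<comment> \<open>If \<open>D\<close> treated both orders alike, \<open>all\<close> would put
        all or no edges between the classes.\<close>
      have "((col u, col v) \<in> D) \<noteq> ((col v, col u) \<in> D)"
        using 3 all unfolding complete_between_def empty_between_def by metis
      then show ?thesis
        using 3 all[OF u v] u v wf neq[OF u v uv] unfolding joined_def P_def by auto
    qed
  qed
  have deg: "pdeg P (f v) b = vdeg v b" if v: "v < n" "col v \<noteq> b" for v b
  proof -
    have "{j. j < n \<and> (w j = b \<and> join P (f v) j)} = f ` {u. u < n \<and> (col u = b \<and> adj v u)}"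
      (is "?A = f ` ?B")
    proof (intro equalityI subsetI)
      fix j assume j: "j \<in> ?A"
      then obtain u where "u < n" "f u = j" using f_surj by blast
      then show "j \<in> f ` ?B" using j join[of v u] wf v by auto
    next
      fix j assume "j \<in> f ` ?B"
      then obtain u where u: "u < n" "col u = b" "adj v u" "j = f u" by blast
      moreover have "f u < n" using f_less u by auto
      ultimately show "j \<in> ?A" using join[of v u] wf v by auto
    qed
    moreover have "inj_on f ?B" using bij by (auto simp: bij_betw_def inj_on_def)
    ultimately show ?thesis unfolding vertex_deg_def pos_deg_def by (simp add: card_image)
  qed
  have noclash: "\<not> clash n adj col w e b P c P" if "e \<noteq> b" "e \<noteq> c" for e b c
  proof -
    have "card {v. v < n \<and> (col v = e \<and> vdeg v b = p \<and> vdeg v c = q)} =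
          card {i. i < n \<and> (w i = e \<and> pdeg P i b = p \<and> pdeg P i c = q)}" for p q
    proof -
      have "{i. i < n \<and> (w i = e \<and> pdeg P i b = p \<and> pdeg P i c = q)} =
        f ` {v. v < n \<and> (col v = e \<and> vdeg v b = p \<and> vdeg v c = q)}" (is "?A = f ` ?B")
      proof (intro equalityI subsetI)
        fix j assume j: "j \<in> ?A"
        then obtain u where "u < n" "f u = j" using f_surj by blast
        then show "j \<in> f ` ?B" using j deg wf that by auto
      next
        fix j assume "j \<in> f ` ?B"
        then obtain u where u: "u \<in> ?B" "j = f u" by blast
        moreover have "f u < n" using f_less u by auto
        ultimately show "j \<in> ?A" using deg wf that by auto
      qed
      moreover have "inj_on f ?B" using bij by (auto simp: bij_betw_def inj_on_def)
      ultimately show ?thesis by (simp add: card_image)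
    qed
    then show ?thesis unfolding clash_def by blast
  qed
  \<comment> \<open>As \<open>f\<close> matches all degrees, no two true literals conflict. So truth
    under \<open>P\<close> propagates along implications, and no literal can be equivalent to its
    negation.\<close>
  have step: "P c d" if imp: "((a, b), (c, d)) \<in> implications n adj col w" and ab: "P a b" for a b c d
  proof (rule ccontr)
    assume "\<not> P c d"
    from imp have c: "a < n" "b < n" "c < n" "d < n" "a \<noteq> b" "c \<noteq> d" "d \<noteq> c"
      "conflict n adj col w a b d c"
      by (auto simp: implications_def)
    have dc: "P d c" using P c(3,4,6) \<open>\<not> P c d\<close> unfolding orientation_def by blast
    obtain e b' c' where "clash n adj col w e b' P c' P" "e \<noteq> b'" "e \<noteq> c'"
      using c conflict_orientation[OF P ab c(1,2,5) dc c(4,3,7)] by blast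
    then show False using noclash by blast
  qed
  have steps: "case m of (c, d) \<Rightarrow> P c d" if "(l, m) \<in> (implications n adj col w)\<^sup>+" "case l of (a, b) \<Rightarrow> P a b" for l m
    using that by induction (auto dest: step)
  have "\<not> (((a, b), (b, a)) \<in> (implications n adj col w)\<^sup>+ \<and> ((b, a), (a, b)) \<in> (implications n adj col w)\<^sup>+)"
    if "a < n" "b < n" for a b
  proof
    assume A: "((a, b), (b, a)) \<in> (implications n adj col w)\<^sup>+ \<and> ((b, a), (a, b)) \<in> (implications n adj col w)\<^sup>+"
    then have "a \<noteq> b" by (auto elim!: converse_tranclE simp: implications_def)
    then have "P a b \<longleftrightarrow> \<not> P b a" using P that unfolding orientation_def by blast
    then show False using A steps[of "(a, b)" "(b, a)"] steps[of "(b, a)" "(a, b)"] by auto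
  qed
  with hom show ?thesis unfolding satisfiable_def by blast
qed

lemma satisfiable_imp_orientation:
  assumes "satisfiable n adj col w"
  obtains P where "orientation P" "\<And>a. \<not> P a a"
    "\<And>e b c. e < n \<Longrightarrow> b < n \<Longrightarrow> c < n \<Longrightarrow> e \<noteq> b \<Longrightarrow> e \<noteq> c \<Longrightarrow> \<not> clash n adj col w e b P c P"
proof -
  let ?R = "implications n adj col w"
  define L where "L = {(a, b). a < n \<and> b < n \<and> a \<noteq> b}"
  have "\<exists>S\<subseteq>L. (\<forall>l\<in>L. l \<in> S \<longleftrightarrow> prod.swap l \<notin> S) \<and> ?R `` S \<subseteq> S"
  proof (rule two_sat)
    have "L \<subseteq> {..<n} \<times> {..<n}" by (auto simp: L_def)
    then show "finite L" by (rule finite_subset) simp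
    show "?R \<subseteq> L \<times> L" by (auto simp: L_def implications_def)
    show "(prod.swap m, prod.swap l) \<in> ?R" if "(l, m) \<in> ?R" for l m
      using that conflict_sym by (auto simp: implications_def)
    show "\<not> ((l, prod.swap l) \<in> ?R\<^sup>+ \<and> (prod.swap l, l) \<in> ?R\<^sup>+)" if "l \<in> L" for l
      using that assms unfolding satisfiable_def L_def by auto
  qed (auto simp: L_def)
  then obtain S where S: "S \<subseteq> L" "\<forall>l\<in>L. l \<in> S \<longleftrightarrow> prod.swap l \<notin> S" "?R `` S \<subseteq> S"
    by blast
  define P where "P a b \<longleftrightarrow> (a, b) \<in> S" for a b
  have PP: "P a b \<longleftrightarrow> \<not> P b a" if "a < n" "b < n" "a \<noteq> b" for a b
    using bspec[OF S(2), of "(a, b)"] that by (simp add: P_def L_def)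
  then have P: "orientation P" unfolding orientation_def by blast
  have irr: "\<not> P a a" for a using S(1) by (auto simp: P_def L_def)
  have noconf: "\<not> conflict n adj col w a b c d" if "P a b" "P c d" for a b c d
  proof
    assume c: "conflict n adj col w a b c d"
    have "(a, b) \<in> L" "(c, d) \<in> L" using that S(1) by (auto simp: P_def)
    \<comment> \<open>A conflict of two true literals makes the first one imply the negation of the
      second.\<close>
    then have "((a, b), (d, c)) \<in> ?R" using c by (auto simp: implications_def L_def)
    then have "P d c" using that S(3) by (auto simp: P_def)
    then show False using PP[of c d] \<open>(c, d) \<in> L\<close> that by (simp add: L_def)
  qed
  have "\<not> clash n adj col w e b P c P"
    if ebc: "e < n" "b < n" "c < n" "e \<noteq> b" "e \<noteq> c" for e b c
  proof
    assume cl: "clash n adj col w e b P c P"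
    obtain x y where xy: "P x y" "e = x \<and> b = y \<or> e = y \<and> b = x"
      using P ebc unfolding orientation_def by blast
    obtain x' y' where xy': "P x' y'" "e = x' \<and> c = y' \<or> e = y' \<and> c = x'"
      using P ebc unfolding orientation_def by blast
    have less: "x < n" "y < n" "x \<noteq> y" "x' < n" "y' < n" "x' \<noteq> y'"
      using xy xy' ebc by auto
    have "conflict n adj col w x y x' y'"
      using conflict_orientation[OF P xy(1) less(1-3) xy'(1) less(4-6)] cl xy xy' ebc by blast
    then show False using noconf xy xy' by blast
  qed
  with P irr show thesis using that by blast
qed

text \<open>Leaving out the vertex itself gives the strict bound that the ranges of \<open>p\<close>
  and \<open>q\<close> in \<open>clash\<close> rely on.\<close>

lemma vdeg_less: "v < n \<Longrightarrow> vdeg v b < n"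
proof -
  assume v: "v < n"
  have "vdeg v b \<le> card ({..<n} - {v})"
    unfolding vertex_deg_def using adj_irrefl[OF v] by (intro card_mono) auto
  then show ?thesis using v by simp
qed

lemma pdeg_less: "i < n \<Longrightarrow> pdeg P i b < n"
proof -
  assume i: "i < n"
  have "pdeg P i b \<le> card ({..<n} - {i})"
    unfolding pos_deg_def by (intro card_mono) (auto simp: joined_def)
  then show ?thesis using i by simp
qed

text \<open>A later occurrence of \<open>e\<close> has no more letters \<open>b\<close> to its right
  and no fewer to its left; \<open>P e b\<close> counts the former and \<open>P b e\<close> the
  latter. Between classes joined by all or no edges the degree is constant.\<close>

lemma pdeg_monotone:
  assumes P: "orientation P" and e: "e < n" "b < n" "e \<noteq> b"
  shows "(\<forall>i\<in>{i. i < n \<and> w i = e}. \<forall>j\<in>{i. i < n \<and> w i = e}. i \<le> j \<longrightarrow> pdeg P i b \<le> pdeg P j b) \<or>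
         (\<forall>i\<in>{i. i < n \<and> w i = e}. \<forall>j\<in>{i. i < n \<and> w i = e}. i \<le> j \<longrightarrow> pdeg P j b \<le> pdeg P i b)"
proof (cases "P e b")
  case True
  then have "\<not> P b e" using P e unfolding orientation_def by blast
  then have "pdeg P j b \<le> pdeg P i b" if "w i = e" "w j = e" "i \<le> j" for i j
    using True that e unfolding pos_deg_def joined_def by (intro card_mono) auto
  then show ?thesis by blast
next
  case False
  then have "P b e" using P e unfolding orientation_def by blast
  then have "pdeg P i b \<le> pdeg P j b" if "w i = e" "w j = e" "i \<le> j" for i j
    using False that e unfolding pos_deg_def joined_def by (intro card_mono) auto
  then show ?thesis by blast
qed

lemma orientation_imp_matching:
  assumes P: "orientation P"
    and noclash: "\<And>e b c. e < n \<Longrightarrow> b < n \<Longrightarrow> c < n \<Longrightarrow> e \<noteq> b \<Longrightarrow> e \<noteq> c \<Longrightarrow> \<not> clash n adj col w e b P c P"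
  obtains f where "bij_betw f {..<n} {..<n}" "\<And>v. v < n \<Longrightarrow> w (f v) = col v"
    "\<And>v b. v < n \<Longrightarrow> b < n \<Longrightarrow> col v \<noteq> b \<Longrightarrow> vdeg v b = pdeg P (f v) b"
proof -
  have "\<exists>f. bij_betw f {v. v < n \<and> col v = e} {i. i < n \<and> w i = e} \<and>
          (\<forall>v\<in>{v. v < n \<and> col v = e}. \<forall>b\<in>{b. b < n \<and> e \<noteq> b}. vdeg v b = pdeg P (f v) b)"
    if e: "e < n" for e
  proof (rule matching_from_pairs)
    show "card {v. v < n \<and> col v = e} = card {i. i < n \<and> w i = e}" by (rule card_class)
    fix b assume b: "b \<in> {b. b < n \<and> e \<noteq> b}"
    then show "(\<forall>i\<in>{i. i < n \<and> w i = e}. \<forall>j\<in>{i. i < n \<and> w i = e}. i \<le> j \<longrightarrow> pdeg P i b \<le> pdeg P j b) \<or>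
         (\<forall>i\<in>{i. i < n \<and> w i = e}. \<forall>j\<in>{i. i < n \<and> w i = e}. i \<le> j \<longrightarrow> pdeg P j b \<le> pdeg P i b)"
      using pdeg_monotone[OF P e] by simp
    fix c p q assume c: "c \<in> {b. b < n \<and> e \<noteq> b}"
    show "card {v \<in> {v. v < n \<and> col v = e}. vdeg v b = p \<and> vdeg v c = q} =
        card {i \<in> {i. i < n \<and> w i = e}. pdeg P i b = p \<and> pdeg P i c = q}"
    proof (cases "p < n \<and> q < n")
      case True
      then show ?thesis
        using noclash[of e b c] e b c unfolding clash_def by (simp add: conj_assoc)
    next
      case False
      then have "{v \<in> {v. v < n \<and> col v = e}. vdeg v b = p \<and> vdeg v c = q} = {}"
        and "{i \<in> {i. i < n \<and> w i = e}. pdeg P i b = p \<and> pdeg P i c = q} = {}"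
        using vdeg_less pdeg_less by auto
      then show ?thesis by (simp only: card.empty)
    qed
  qed auto
  then have "\<forall>e\<in>{..<n}. \<exists>f. bij_betw f {v. v < n \<and> col v = e} {i. i < n \<and> w i = e} \<and>
          (\<forall>v\<in>{v. v < n \<and> col v = e}. \<forall>b\<in>{b. b < n \<and> e \<noteq> b}. vdeg v b = pdeg P (f v) b)"
    by blast
  from bchoice[OF this] obtain F where
    FF: "\<And>e. e < n \<Longrightarrow> bij_betw (F e) {v. v < n \<and> col v = e} {i. i < n \<and> w i = e} \<and>
          (\<forall>v\<in>{v. v < n \<and> col v = e}. \<forall>b\<in>{b. b < n \<and> e \<noteq> b}. vdeg v b = pdeg P (F e v) b)"
    by blast
  have F: "bij_betw (F e) {v. v < n \<and> col v = e} {i. i < n \<and> w i = e}" if "e < n" for e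
    using FF[OF that] by simp
  have Fdeg: "vdeg v b = pdeg P (F e v) b" if "e < n" "v < n" "col v = e" "b < n" "e \<noteq> b" for e v b
    using FF[OF that(1)] that by simp
  \<comment> \<open>The bijections of the single classes are glued. Colors are preserved, so the
    result is injective, hence a permutation of \<open>{..<n}\<close>.\<close>
  define f where "f v = F (col v) v" for v
  have f: "f v < n \<and> w (f v) = col v" if "v < n" for v
    using bij_betwE[OF F[OF col_less[OF that]]] that by (simp add: f_def)
  have "inj_on f {..<n}"
  proof (rule inj_onI)
    fix u v assume u: "u \<in> {..<n}" and v: "v \<in> {..<n}" and eq: "f u = f v"
    have c: "col u = col v" using f[of u] f[of v] eq u v by simp
    show "u = v"
      by (rule inj_onD[OF bij_betw_imp_inj_on[OF F[OF col_less[of u]]]])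
         (use u v eq c in \<open>auto simp: f_def\<close>)
  qed
  moreover have "f ` {..<n} \<subseteq> {..<n}" using f by auto
  ultimately have "bij_betw f {..<n} {..<n}"
    by (simp add: bij_betw_def endo_inj_surj)
  moreover have "vdeg v b = pdeg P (f v) b" if "v < n" "b < n" "col v \<noteq> b" for v b
    using Fdeg[of "col v" v b] col_less that by (simp add: f_def)
  ultimately show thesis using that f by blast
qed

text \<open>The matching only preserves degrees. Between two classes joined by some but not all
  edges, the graph prescribed by \<open>P\<close> is a threshold graph in the positions, so equal
  degrees on both sides force equal edges.\<close>

lemma satisfiable_imp_realizable:
  assumes sat: "satisfiable n adj col w"
  shows "realizable n adj col w"
proof -
  from satisfiable_imp_orientation[OF sat] obtain P where P: "orientation P" "\<And>a. \<not> P a a"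
    and nc: "\<And>e b c. e < n \<Longrightarrow> b < n \<Longrightarrow> c < n \<Longrightarrow> e \<noteq> b \<Longrightarrow> e \<noteq> c \<Longrightarrow> \<not> clash n adj col w e b P c P"
    by metis
  obtain f where bij: "bij_betw f {..<n} {..<n}"
    and wf: "\<And>v. v < n \<Longrightarrow> w (f v) = col v"
    and deg: "\<And>v b. v < n \<Longrightarrow> b < n \<Longrightarrow> col v \<noteq> b \<Longrightarrow> vdeg v b = pdeg P (f v) b"
    using orientation_imp_matching[OF P(1)] nc by blast
  have hom: "compl a a \<or> empt a a" if "a < n" for a
    using sat that unfolding satisfiable_def homogeneous_def by blast
  have neq: "f u \<noteq> f v" if "u < n" "v < n" "u \<noteq> v" for u v
    using bij that by (auto simp: bij_betw_def inj_on_def)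
  have f_less: "f u < n" if "u < n" for u using bij that by (auto simp: bij_betw_def)
  have f_surj: "\<exists>u<n. f u = j" if "j < n" for j
    using bij that by (metis bij_betw_def imageE lessThan_iff)
  define D where "D = {(a, b). compl a b \<or> \<not> empt a b \<and> P a b}"
  have row: "card {u \<in> {u. u < n \<and> col u = b}. adj v u} = card {u \<in> {u. u < n \<and> col u = b}. join P (f v) (f u)}"
    if v: "v < n" "b < n" "col v \<noteq> b" for v b
  proof -
    have "{j. j < n \<and> (w j = b \<and> join P (f v) j)} = f ` {u \<in> {u. u < n \<and> col u = b}. join P (f v) (f u)}"
      (is "?A = f ` ?B")
    proof (intro equalityI subsetI)
      fix j assume j: "j \<in> ?A"
      then obtain u where "u < n" "f u = j" using f_surj by blast
      then show "j \<in> f ` ?B" using j wf by auto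
    next
      fix j assume "j \<in> f ` ?B"
      then obtain u where u: "u \<in> ?B" "j = f u" by blast
      moreover have "f u < n" using f_less u by auto
      ultimately show "j \<in> ?A" using wf by auto
    qed
    moreover have "inj_on f ?B" using bij by (auto simp: bij_betw_def inj_on_def)
    ultimately show ?thesis
      using deg[OF v] unfolding vertex_deg_def pos_deg_def by (simp add: card_image conj_assoc)
  qed
  have adj: "adj u v \<longleftrightarrow> (col u, col v) \<in> D" if u: "u < n" and v: "v < n" and lt: "f u < f v" for u v
  proof -
    let ?a = "col u" and ?b = "col v"
    have uv: "u \<noteq> v" using lt by auto
    consider "compl ?a ?b" | "empt ?a ?b" | "\<not> compl ?a ?b" "\<not> empt ?a ?b" by blast
    then show ?thesis
    proof cases
      case 1
      then show ?thesis using u v uv unfolding D_def complete_between_def by auto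
    next
      case 2
      then have "\<not> adj u v" using u v uv unfolding empty_between_def by blast
      moreover from this have "\<not> compl ?a ?b" using u v uv unfolding complete_between_def by blast
      ultimately show ?thesis using 2 by (simp add: D_def)
    next
      case 3
      then have ab: "?a \<noteq> ?b" using hom[OF col_less[OF u]] by metis
      \<comment> \<open>With this sign, positions \<open>f u\<close> and \<open>f v\<close> are
        joined iff \<open>?s * (f v - f u)\<close> is positive; so the positions serve as
        weights.\<close>
      let ?s = "if P ?a ?b then 1 else - 1 :: int"
      let ?A = "{u'. u' < n \<and> col u' = ?a}" and ?B = "{v'. v' < n \<and> col v' = ?b}"
      have PP: "P ?b ?a \<longleftrightarrow> \<not> P ?a ?b"
        using P(1) ab col_less u v unfolding orientation_def by blast
      have "adj u v \<longleftrightarrow> join P (f u) (f v)"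
      proof (rule threshold_graph_unique[where A = ?A and B = ?B and g = "\<lambda>u. - ?s * int (f u)"
            and h = "\<lambda>v. ?s * int (f v)" and E = adj and F = "\<lambda>u v. join P (f u) (f v)"])
        fix u' v' assume u': "u' \<in> ?A" and v': "v' \<in> ?B"
        then have "u' \<noteq> v'" using ab by auto
        then have "f u' \<noteq> f v'" using neq[of u' v'] u' v' by simp
        then show "- ?s * int (f u') + ?s * int (f v') \<noteq> 0" by auto
        show "join P (f u') (f v') \<longleftrightarrow> - ?s * int (f u') + ?s * int (f v') > 0"
          using u' v' wf 3 PP \<open>f u' \<noteq> f v'\<close> unfolding joined_def by auto
      next
        fix u' assume "u' \<in> ?A"
        then show "card {v' \<in> ?B. adj u' v'} = card {v' \<in> ?B. join P (f u') (f v')}"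
          using row[of u' ?b] ab col_less v by simp
      next
        fix v' assume v': "v' \<in> ?B"
        have "{u' \<in> ?A. adj u' v'} = {u' \<in> ?A. adj v' u'}" using adj_sym v' by auto
        moreover have "{u' \<in> ?A. join P (f u') (f v')} = {u' \<in> ?A. join P (f v') (f u')}"
          using join_sym by blast
        ultimately show "card {u' \<in> ?A. adj u' v'} = card {u' \<in> ?A. join P (f u') (f v')}"
          using row[of v' ?a] v' ab col_less u by simp
      qed (use u v in auto)
      also have "\<dots> \<longleftrightarrow> (?a, ?b) \<in> D" using lt 3 u v wf by (auto simp: joined_def D_def)
      finally show ?thesis .
    qed
  qed
  show ?thesis
    unfolding realizable_def using bij wf adj by blast
qed

theorem realizable_iff_satisfiable: "realizable n adj col w \<longleftrightarrow> satisfiable n adj col w"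
  using realizable_imp_satisfiable satisfiable_imp_realizable by blast

end

section \<open>The transitive closure\<close>

abbreviation inp_adj :: "(nat \<Rightarrow> nat) \<Rightarrow> nat \<Rightarrow> nat \<Rightarrow> bool" where
  "inp_adj x u v \<equiv> x (2 + (u * x 0 + v)) = 1"

abbreviation inp_col :: "(nat \<Rightarrow> nat) \<Rightarrow> nat \<Rightarrow> nat" where
  "inp_col x v \<equiv> x (2 + (x 0 * x 0 + v))"

abbreviation inp_word :: "(nat \<Rightarrow> nat) \<Rightarrow> nat \<Rightarrow> nat" where
  "inp_word x i \<equiv> x (2 + (x 0 * x 0 + (x 0 + i)))"

text \<open>Index 0 is left free for the answer.\<close>

definition cell :: "nat \<Rightarrow> nat \<Rightarrow> nat \<Rightarrow> nat \<Rightarrow> nat \<Rightarrow> nat" where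
  "cell n a b c d = ((a * n + b) * n + c) * n + d + 1"

lemma fold_all:
  assumes "Inv m" "\<And>j m. j < n \<Longrightarrow> Inv m \<Longrightarrow> Inv (f j m)"
  shows "Inv (fold f [0..<n] m)"
  using assms by (induction n) auto

definition init_phase :: "nat \<Rightarrow> (nat \<Rightarrow> nat \<Rightarrow> nat \<Rightarrow> nat \<Rightarrow> bool) \<Rightarrow> (nat \<Rightarrow> nat) \<Rightarrow> nat \<Rightarrow> nat" where
  "init_phase n Q = fold (\<lambda>a. fold (\<lambda>b. fold (\<lambda>c. fold (\<lambda>d m.
     mark (Q a b c d) (cell n a b c d) m) [0..<n]) [0..<n]) [0..<n]) [0..<n]"

text \<open>The pass works in place and may already use marks that it has just set. They stay within
  the closure, and completeness only relies on one more edge per pass.\<close>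

definition closure_step :: "nat \<Rightarrow> (nat \<Rightarrow> nat) \<Rightarrow> nat \<Rightarrow> nat" where
  "closure_step n = fold (\<lambda>a. fold (\<lambda>b. fold (\<lambda>c. fold (\<lambda>d. fold (\<lambda>e. fold (\<lambda>f m.
     mark (m (cell n a b c d) \<noteq> 0 \<and> m (cell n c d e f) \<noteq> 0) (cell n a b e f) m)
       [0..<n]) [0..<n]) [0..<n]) [0..<n]) [0..<n]) [0..<n]"

text \<open>A loop makes exactly \<open>n\<close> rounds, so four of them repeat the step
  \<open>n ^ 4\<close> times. This is the number of pairs of literals and bounds the length of the
  paths to be found.\<close>

definition closure_phase :: "nat \<Rightarrow> (nat \<Rightarrow> nat) \<Rightarrow> nat \<Rightarrow> nat" where
  "closure_phase n = fold (\<lambda>_. fold (\<lambda>_. fold (\<lambda>_. fold (\<lambda>_. closure_step n)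
      [0..<n]) [0..<n]) [0..<n]) [0..<n]"

definition final_phase :: "(nat \<Rightarrow> nat) \<Rightarrow> (nat \<Rightarrow> nat) \<Rightarrow> nat \<Rightarrow> nat" where
  "final_phase x m = mark (homogeneous (x 0) (inp_adj x) (inp_col x) \<and>
     (\<forall>a<x 0. \<forall>b<x 0. \<not> (m (cell (x 0) a b b a) \<noteq> 0 \<and> m (cell (x 0) b a a b) \<noteq> 0))) 0 m"

definition decide :: "(nat \<Rightarrow> nat) \<Rightarrow> (nat \<Rightarrow> nat) \<Rightarrow> nat \<Rightarrow> nat" where
  "decide x m = final_phase x (closure_phase (x 0) (init_phase (x 0) (\<lambda>a b c d.
     a \<noteq> b \<and> c \<noteq> d \<and> conflict (x 0) (inp_adj x) (inp_col x) (inp_word x) a b d c) m))"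

lemma computable_decide: "computable_update (\<lambda>x \<rho>. decide x)"
proof -
  have 1: "computable_update (\<lambda>x \<rho>. init_phase (x 0) (\<lambda>a b c d.
     a \<noteq> b \<and> c \<noteq> d \<and> conflict (x 0) (inp_adj x) (inp_col x) (inp_word x) a b d c))"
    unfolding init_phase_def conflict_def clash_def pos_deg_def vertex_deg_def joined_def
      complete_between_def empty_between_def cell_def
    by (intro computable_for computable_mark definable_intros)
  have 2: "computable_update (\<lambda>x \<rho>. closure_phase (x 0))"
    unfolding closure_phase_def closure_step_def cell_def
    by (intro computable_for computable_mark definable_intros)
  have 3: "computable_update (\<lambda>x \<rho>. final_phase x)"
    unfolding final_phase_def homogeneous_def complete_between_def empty_between_def cell_def
    by (intro computable_mark definable_intros)
  show ?thesis
    unfolding decide_def by (rule computable_comp[OF computable_comp[OF 1 2] 3])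
qed

section \<open>Correctness of the closure computed in place\<close>

definition pair_cell :: "nat \<Rightarrow> (nat \<times> nat) \<times> (nat \<times> nat) \<Rightarrow> nat" where
  "pair_cell n = (\<lambda>((a, b), (c, d)). cell n a b c d)"

definition pairs_below :: "nat \<Rightarrow> ((nat \<times> nat) \<times> (nat \<times> nat)) set" where
  "pairs_below n = ({..<n} \<times> {..<n}) \<times> ({..<n} \<times> {..<n})"

lemma mult_add_inj: "a * n + b = a' * n + b' \<longleftrightarrow> a = a' \<and> b = b'"
  if "b < n" "b' < n" for a b a' b' n :: nat
proof
  assume eq: "a * n + b = a' * n + b'"
  have "b = b'" using arg_cong[OF eq, of "\<lambda>k. k mod n"] that by simp
  moreover have "a = a'" using arg_cong[OF eq, of "\<lambda>k. k div n"] that by simp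
  ultimately show "a = a' \<and> b = b'" by simp
qed simp

lemma inj_pair_cell: "inj_on (pair_cell n) (pairs_below n)"
  by (rule inj_onI) (auto simp: pair_cell_def pairs_below_def cell_def mult_add_inj)

definition reaches :: "nat set \<Rightarrow> nat \<Rightarrow> ((nat \<Rightarrow> nat) \<Rightarrow> nat \<Rightarrow> nat) \<Rightarrow> bool" where
  "reaches Y z f \<longleftrightarrow> (\<forall>m. (\<forall>y\<in>Y. m y \<noteq> 0) \<longrightarrow> f m z \<noteq> 0)"

definition increasing :: "((nat \<Rightarrow> nat) \<Rightarrow> nat \<Rightarrow> nat) \<Rightarrow> bool" where
  "increasing f \<longleftrightarrow> (\<forall>m z. m z \<noteq> 0 \<longrightarrow> f m z \<noteq> 0)"

lemma increasing_mark: "increasing (\<lambda>m. mark (P m) z m)"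
  by (simp add: increasing_def mark_def)

lemma increasing_fold_list: "(\<And>j. j \<in> set js \<Longrightarrow> increasing (f j)) \<Longrightarrow> increasing (fold f js)"
  by (induction js) (auto simp: increasing_def)

lemma increasing_fold: "(\<And>j. increasing (f j)) \<Longrightarrow> increasing (fold f [0..<n])"
  by (rule increasing_fold_list)

text \<open>One suitable round is enough. Marks are never erased, so those in \<open>Y\<close> are
  still present when round \<open>k\<close> starts, and \<open>z\<close> stays marked
  afterwards.\<close>

lemma reaches_fold:
  assumes inc: "\<And>j. increasing (f j)" and k: "k < n" and reach: "reaches Y z (f k)"
  shows "reaches Y z (fold f [0..<n])"
  unfolding reaches_def
proof (intro allI impI)
  fix m assume m: "\<forall>y\<in>Y. m y \<noteq> (0 :: nat)"
  have "[0..<n] = [0..<k] @ k # [Suc k..<n]"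
    using k by (metis le_add1 less_imp_le_nat plus_nat.add_0 upt_add_eq_append upt_conv_Cons le_add_diff_inverse)
  then have "fold f [0..<n] m = fold f [Suc k..<n] (f k (fold f [0..<k] m))" by simp
  moreover have "\<forall>y\<in>Y. fold f [0..<k] m y \<noteq> 0"
    using increasing_fold[of f k, OF inc] m by (simp add: increasing_def)
  ultimately show "fold f [0..<n] m z \<noteq> 0"
    using increasing_fold_list[of "[Suc k..<n]" f, OF inc] reach by (simp add: reaches_def increasing_def)
qed

lemma reaches_mark: "(\<And>m. (\<forall>y\<in>Y. m y \<noteq> 0) \<Longrightarrow> P m) \<Longrightarrow> reaches Y z (\<lambda>m. mark (P m) z m)"
  by (simp add: reaches_def mark_def)

definition marks_within :: "nat \<Rightarrow> ((nat \<times> nat) \<times> (nat \<times> nat)) set \<Rightarrow> (nat \<Rightarrow> nat) \<Rightarrow> bool" where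
  "marks_within n T m \<longleftrightarrow> (\<forall>z. m z \<noteq> 0 \<longrightarrow> z \<in> pair_cell n ` T)"

lemma marks_within_mark:
  "marks_within n T m \<Longrightarrow> (P \<Longrightarrow> ((a, b), (c, d)) \<in> T) \<Longrightarrow> marks_within n T (mark P (cell n a b c d) m)"
  by (force simp: marks_within_def mark_def pair_cell_def)

lemma marks_within_cell:
  assumes "marks_within n T m" "T \<subseteq> pairs_below n" "m (pair_cell n l) \<noteq> 0" "l \<in> pairs_below n"
  shows "l \<in> T"
  using assms inj_pair_cell[of n] unfolding marks_within_def inj_on_def by blast

context
  fixes n :: nat and Q :: "nat \<Rightarrow> nat \<Rightarrow> nat \<Rightarrow> nat \<Rightarrow> bool" and R
  assumes R: "R = {((a, b), (c, d)) | a b c d. a < n \<and> b < n \<and> c < n \<and> d < n \<and> Q a b c d}"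
begin

lemma R_below: "R \<subseteq> pairs_below n" "R\<^sup>+ \<subseteq> pairs_below n"
proof -
  show "R \<subseteq> pairs_below n" by (auto simp: R pairs_below_def)
  then show "R\<^sup>+ \<subseteq> pairs_below n" using trancl_subset_Sigma by (simp add: pairs_below_def)
qed

lemma init_phase_within: "marks_within n R (init_phase n Q (\<lambda>_. 0))"
  unfolding init_phase_def
  by (intro fold_all[where Inv = "marks_within n R"] marks_within_mark)
     (auto simp: R marks_within_def)

lemma init_phase_complete:
  assumes "l \<in> R"
  shows "init_phase n Q m (pair_cell n l) \<noteq> 0"
proof -
  obtain a b c d where l: "l = ((a, b), (c, d))" by (metis surj_pair)
  have less: "a < n" "b < n" "c < n" "d < n" using assms R_below by (auto simp: l pairs_below_def)
  have "reaches {} (cell n a b c d) (init_phase n Q)"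
    unfolding init_phase_def
    by (rule reaches_fold[OF _ less(1)], intro increasing_fold increasing_mark,
        rule reaches_fold[OF _ less(2)], intro increasing_fold increasing_mark,
        rule reaches_fold[OF _ less(3)], intro increasing_fold increasing_mark,
        rule reaches_fold[OF _ less(4)], intro increasing_fold increasing_mark,
        rule reaches_mark) (use assms in \<open>auto simp: l R\<close>)
  then show ?thesis by (simp add: reaches_def l pair_cell_def)
qed

lemma closure_step_within:
  assumes "marks_within n (R\<^sup>+) m"
  shows "marks_within n (R\<^sup>+) (closure_step n m)"
  unfolding closure_step_def
proof (intro fold_all[where Inv = "marks_within n (R\<^sup>+)"] marks_within_mark assms)
  fix a b c d e f m
  assume m: "marks_within n (R\<^sup>+) m" and "a < n" "b < n" "c < n" "d < n" "e < n" "f < n"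
    and marked: "m (cell n a b c d) \<noteq> 0 \<and> m (cell n c d e f) \<noteq> 0"
  then have "((a, b), (c, d)) \<in> R\<^sup>+" "((c, d), (e, f)) \<in> R\<^sup>+"
    by (auto intro!: marks_within_cell[OF m R_below(2)] simp: pair_cell_def pairs_below_def)
  then show "((a, b), (e, f)) \<in> R\<^sup>+" by (rule trancl_trans)
qed

lemma increasing_closure_step: "increasing (closure_step n)"
  unfolding closure_step_def by (intro increasing_fold increasing_mark)

lemma closure_step_reaches:
  assumes "(k, l) \<in> pairs_below n" "(l, k') \<in> pairs_below n"
    and "m (pair_cell n (k, l)) \<noteq> 0" "m (pair_cell n (l, k')) \<noteq> 0"
  shows "closure_step n m (pair_cell n (k, k')) \<noteq> 0"
proof -
  obtain a b c d e f where l: "k = (a, b)" "l = (c, d)" "k' = (e, f)" by (metis surj_pair)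
  have less: "a < n" "b < n" "c < n" "d < n" "e < n" "f < n"
    using assms by (auto simp: l pairs_below_def)
  have "reaches {cell n a b c d, cell n c d e f} (cell n a b e f) (closure_step n)"
    unfolding closure_step_def
    by (rule reaches_fold[OF _ less(1)], intro increasing_fold increasing_mark,
        rule reaches_fold[OF _ less(2)], intro increasing_fold increasing_mark,
        rule reaches_fold[OF _ less(3)], intro increasing_fold increasing_mark,
        rule reaches_fold[OF _ less(4)], intro increasing_fold increasing_mark,
        rule reaches_fold[OF _ less(5)], intro increasing_fold increasing_mark,
        rule reaches_fold[OF _ less(6)], intro increasing_fold increasing_mark,
        rule reaches_mark) auto
  then show ?thesis using assms(3,4) by (simp add: reaches_def l pair_cell_def)
qed

lemma fold_const: "fold (\<lambda>_. g) [0..<k] = g ^^ k"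
  by (induction k) (simp_all add: fun_eq_iff)

lemma closure_phase_funpow: "closure_phase n = closure_step n ^^ (n * n * n * n)"
  unfolding closure_phase_def fold_const funpow_mult by (simp add: mult.assoc)

lemma closure_steps_within: "marks_within n (R\<^sup>+) ((closure_step n ^^ i) (init_phase n Q (\<lambda>_. 0)))"
proof (induction i)
  case 0
  have "pair_cell n ` R \<subseteq> pair_cell n ` R\<^sup>+" by auto
  then show ?case using init_phase_within by (simp add: marks_within_def subset_iff)
qed (simp add: closure_step_within)

text \<open>Every pass appends one edge to the paths found so far; \<open>Suc i\<close> appears
  because the initial marks already cover the paths of length 1.\<close>

lemma closure_steps_complete:
  assumes "(k, l) \<in> R ^^ j" "0 < j" "j \<le> Suc i"
  shows "(closure_step n ^^ i) (init_phase n Q m) (pair_cell n (k, l)) \<noteq> 0"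
  using assms
proof (induction i arbitrary: j k l)
  case 0
  then have "(k, l) \<in> R" by (simp add: le_Suc_eq)
  then show ?case using init_phase_complete by simp
next
  case (Suc i)
  let ?m = "(closure_step n ^^ i) (init_phase n Q m)"
  show ?case
  proof (cases "j \<le> Suc i")
    case True
    then have "?m (pair_cell n (k, l)) \<noteq> 0" using Suc by blast
    then show ?thesis using increasing_closure_step by (simp add: increasing_def)
  next
    case False
    then have "j = Suc (Suc i)" using Suc.prems by simp
    with Suc.prems obtain y where y: "(k, y) \<in> R ^^ Suc i" "(y, l) \<in> R" by auto
    have 1: "?m (pair_cell n (k, y)) \<noteq> 0" using Suc.IH[OF y(1)] by simp
    have 2: "?m (pair_cell n (y, l)) \<noteq> 0" using Suc.IH[of y l 1] y(2) by simp
    have "(k, y) \<in> R\<^sup>+" using y(1) by (metis trancl_power zero_less_Suc)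
    then show ?thesis
      using closure_step_reaches[OF _ _ 1 2] y(2) R_below by auto
  qed
qed

lemma closure_correct:
  assumes "l \<in> pairs_below n"
  shows "closure_phase n (init_phase n Q (\<lambda>_. 0)) (pair_cell n l) \<noteq> 0 \<longleftrightarrow> l \<in> R\<^sup>+"
proof
  assume "closure_phase n (init_phase n Q (\<lambda>_. 0)) (pair_cell n l) \<noteq> 0"
  then show "l \<in> R\<^sup>+"
    using marks_within_cell[OF closure_steps_within R_below(2) _ assms] by (simp add: closure_phase_funpow)
next
  assume l: "l \<in> R\<^sup>+"
  obtain k k' where kk: "l = (k, k')" by (cases l)
  have fin: "finite (pairs_below n)" by (simp add: pairs_below_def)
  then have "finite R" using R_below(1) by (rule rev_finite_subset)
  \<comment> \<open>In a finite relation, paths of length at most \<open>card R\<close> suffice, and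
    \<open>card R\<close> is at most \<open>n ^ 4\<close>.\<close>
  then obtain j where j: "0 < j" "j \<le> card R" "(k, k') \<in> R ^^ j"
    using l trancl_finite_eq_relpow[of R] by (auto simp: kk)
  have "card R \<le> card (pairs_below n)" using R_below(1) fin by (rule card_mono[rotated])
  then have "j \<le> Suc (n * n * n * n)" using j(2) by (simp add: pairs_below_def card_cartesian_product)
  then show "closure_phase n (init_phase n Q (\<lambda>_. 0)) (pair_cell n l) \<noteq> 0"
    using closure_steps_complete[OF j(3,1)] by (simp add: closure_phase_funpow kk)
qed

text \<open>The offset 1 in \<open>cell\<close> keeps the answer cell clear until
  \<open>final_phase\<close>.\<close>

lemma closure_cell_0: "closure_phase n (init_phase n Q (\<lambda>_. 0)) 0 = 0"
  using closure_steps_within[of "n * n * n * n"]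
  by (auto simp: closure_phase_funpow marks_within_def pair_cell_def cell_def)

end

lemma decide_correct:
  "decide x (\<lambda>_. 0) 0 \<noteq> 0 \<longleftrightarrow> satisfiable (x 0) (inp_adj x) (inp_col x) (inp_word x)"
proof -
  let ?n = "x 0"
  let ?R = "implications ?n (inp_adj x) (inp_col x) (inp_word x)"
  let ?Q = "\<lambda>a b c d. a \<noteq> b \<and> c \<noteq> d \<and> conflict ?n (inp_adj x) (inp_col x) (inp_word x) a b d c"
  let ?m = "closure_phase ?n (init_phase ?n ?Q (\<lambda>_. 0))"
  have "?m (cell ?n a b c d) \<noteq> 0 \<longleftrightarrow> ((a, b), (c, d)) \<in> ?R\<^sup>+"
    if "a < ?n" "b < ?n" "c < ?n" "d < ?n" for a b c d
    using closure_correct[OF implications_def, of "((a, b), (c, d))"] that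
    by (simp add: pairs_below_def pair_cell_def)
  moreover have "?m 0 = 0" by (rule closure_cell_0[OF implications_def])
  ultimately show ?thesis
    unfolding decide_def final_phase_def satisfiable_def mark_def by simp
qed

section \<open>Encoded instances\<close>

lemma letter_graph_edge:
  assumes "1 \<le> i" "i < j" "j \<le> length w"
  shows "{i, j} \<in> snd (letter_graph D w) \<longleftrightarrow> (letter_at w i, letter_at w j) \<in> D"
  using assms by (auto simp: letter_graph_def doubleton_eq_iff)

lemma letter_graph_no_loop: "{i, i} \<notin> snd (letter_graph D w)"
  by (auto simp: letter_graph_def doubleton_eq_iff)

text \<open>Edges are unordered and there are no loops on either side, so pairs with
  \<open>f u < f v\<close> decide the isomorphism; on these, the labeling turns letters into
  colors.\<close>

lemma has_decoder_iff:
  assumes fsg: "finite_simple_graph (graph I)"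
  shows "has_decoder I \<longleftrightarrow> (\<exists>D \<subseteq> alphabet I \<times> alphabet I. \<exists>f.
     bij_betw f (fst (graph I)) {1..length (word I)} \<and>
     (\<forall>v\<in>fst (graph I). letter_at (word I) (f v) = coloring I v) \<and>
     (\<forall>u\<in>fst (graph I). \<forall>v\<in>fst (graph I). f u < f v \<longrightarrow>
        ({u, v} \<in> snd (graph I) \<longleftrightarrow> (coloring I u, coloring I v) \<in> D)))"
proof -
  let ?V = "fst (graph I)" and ?E = "snd (graph I)" and ?w = "word I"
  have "graph_isomorphism f (graph I) (letter_graph D ?w) \<longleftrightarrow>
      bij_betw f ?V {1..length ?w} \<and>
      (\<forall>u\<in>?V. \<forall>v\<in>?V. f u < f v \<longrightarrow> ({u, v} \<in> ?E \<longleftrightarrow> (coloring I u, coloring I v) \<in> D))"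
    if lab: "\<forall>v\<in>?V. letter_at ?w (f v) = coloring I v" for D f
  proof (cases "bij_betw f ?V {1..length ?w}")
    case True
    then have range: "1 \<le> f v" "f v \<le> length ?w" if "v \<in> ?V" for v
      using that by (auto dest: bij_betwE)
    have inj: "f u = f v \<longleftrightarrow> u = v" if "u \<in> ?V" "v \<in> ?V" for u v
      using True that by (auto simp: bij_betw_def inj_on_def)
    have edge: "{f u, f v} \<in> snd (letter_graph D ?w) \<longleftrightarrow> (coloring I u, coloring I v) \<in> D"
      if "u \<in> ?V" "v \<in> ?V" "f u < f v" for u v
      using letter_graph_edge[of "f u" "f v" ?w D] range that lab by simp
    have loop: "{v, v} \<notin> ?E" for v
      using fsg unfolding finite_simple_graph_def by force
    have "(\<forall>u\<in>?V. \<forall>v\<in>?V. {u, v} \<in> ?E \<longleftrightarrow> {f u, f v} \<in> snd (letter_graph D ?w)) \<longleftrightarrow>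
      (\<forall>u\<in>?V. \<forall>v\<in>?V. f u < f v \<longrightarrow> ({u, v} \<in> ?E \<longleftrightarrow> (coloring I u, coloring I v) \<in> D))"
      (is "?l \<longleftrightarrow> ?r")
    proof
      assume ?l
      then show ?r using edge by blast
    next
      assume r: ?r
      show ?l
      proof (intro ballI)
        fix u v assume u: "u \<in> ?V" and v: "v \<in> ?V"
        consider "u = v" | "f u < f v" | "f v < f u" using inj[OF u v] by linarith
        then show "{u, v} \<in> ?E \<longleftrightarrow> {f u, f v} \<in> snd (letter_graph D ?w)"
        proof cases
          case 1
          then show ?thesis using loop letter_graph_no_loop by metis
        next
          case 2
          then show ?thesis using r edge u v by blast
        next
          case 3
          then have "{v, u} \<in> ?E \<longleftrightarrow> {f v, f u} \<in> snd (letter_graph D ?w)"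
            using r edge u v by blast
          then show ?thesis by (simp add: insert_commute)
        qed
      qed
    qed
    then show ?thesis using True by (simp add: graph_isomorphism_def letter_graph_def)
  qed (simp add: graph_isomorphism_def letter_graph_def)
  then show ?thesis unfolding has_decoder_def by blast
qed

locale encoded_instance =
  fixes I :: "('v, 'a) instance_data" and vs :: "'v list" and num :: "'a \<Rightarrow> nat" and xs :: "nat list"
  assumes inst: "is_instance I"
    and vs: "distinct vs" "set vs = fst (graph I)"
    and num: "bij_betw num (alphabet I) {..<card (alphabet I)}"
    and xs: "xs = [length vs, card (alphabet I)]
             @ concat (map (\<lambda>u. map (\<lambda>v. if {u, v} \<in> snd (graph I) then 1 else 0) vs) vs)
             @ map (\<lambda>v. num (coloring I v)) vs
             @ map num (word I)"
begin

abbreviation "n \<equiv> length vs"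
abbreviation "x \<equiv> input_memory xs 0"

lemma finite_simple: "finite_simple_graph (graph I)"
  and coloring_in: "v \<in> fst (graph I) \<Longrightarrow> coloring I v \<in> alphabet I"
  and word_in: "set (word I) \<subseteq> alphabet I"
  and length_word: "length (word I) = n"
  and class_nonempty: "a \<in> alphabet I \<Longrightarrow> color_class I a \<noteq> {}"
  and count_word: "a \<in> alphabet I \<Longrightarrow> count_list (word I) a = card (color_class I a)"
  using inst vs distinct_card[OF vs(1)] unfolding is_instance_def by auto

text \<open>The list \<open>us\<close> of rows is arbitrary, here and in \<open>nth_matrix\<close>,
  so that the induction over it leaves the row length \<open>n\<close> unchanged.\<close>

lemma length_matrix:
  "length (concat (map (\<lambda>u. map (f u) vs) us)) = length us * n"
  by (induction us) auto

lemma nth_matrix: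
  "i < length us \<Longrightarrow> j < n \<Longrightarrow> concat (map (\<lambda>u. map (f u) vs) us) ! (i * n + j) = f (us ! i) (vs ! j)"
proof (induction us arbitrary: i)
  case (Cons u us)
  then show ?case by (cases i) (auto simp: nth_append add.assoc)
qed simp

lemma length_xs: "length xs = 2 + (n * n + (n + n))"
  by (simp add: xs length_matrix length_word)

lemma x_eq: "i < length xs \<Longrightarrow> x i = xs ! i"
  by (simp add: input_memory_def)

lemma x_0: "x 0 = n"
  by (simp add: x_eq length_xs) (simp add: xs)

lemma x_adj: "u < n \<Longrightarrow> v < n \<Longrightarrow> inp_adj x u v \<longleftrightarrow> {vs ! u, vs ! v} \<in> snd (graph I)"
proof -
  assume u: "u < n" and v: "v < n"
  have "u * n + v < Suc u * n" using v by simp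
  also have "\<dots> \<le> n * n" using u by (intro mult_right_mono) auto
  finally have less: "u * n + v < n * n" .
  then have "x (2 + (u * n + v)) = xs ! (2 + (u * n + v))" by (intro x_eq) (simp add: length_xs)
  also have "\<dots> = (if {vs ! u, vs ! v} \<in> snd (graph I) then 1 else 0)"
    using less nth_matrix[OF u v, where f = "\<lambda>u v. if {u, v} \<in> snd (graph I) then 1 else 0"]
    unfolding xs by (simp add: nth_append length_matrix)
  finally show ?thesis by (simp add: x_0)
qed

lemma x_col: "v < n \<Longrightarrow> inp_col x v = num (coloring I (vs ! v))"
proof -
  assume v: "v < n"
  then have "x (2 + (n * n + v)) = xs ! (2 + (n * n + v))" by (intro x_eq) (simp add: length_xs)
  also have "\<dots> = num (coloring I (vs ! v))"
    using v unfolding xs by (simp add: nth_append length_matrix)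
  finally show ?thesis by (simp add: x_0)
qed

lemma x_word: "i < n \<Longrightarrow> inp_word x i = num (word I ! i)"
proof -
  assume i: "i < n"
  then have "x (2 + (n * n + (n + i))) = xs ! (2 + (n * n + (n + i)))"
    by (intro x_eq) (simp add: length_xs)
  also have "\<dots> = num (word I ! i)"
    using i unfolding xs by (simp add: nth_append length_matrix length_word)
  finally show ?thesis by (simp add: x_0)
qed

text \<open>Every letter is the color of some vertex. Hence loops up to the number of vertices also
  run through all letters.\<close>

lemma alphabet_le: "card (alphabet I) \<le> n"
proof -
  have "alphabet I \<subseteq> coloring I ` fst (graph I)"
    using class_nonempty by (force simp: color_class_def)
  then have "card (alphabet I) \<le> card (fst (graph I))"
    using finite_simple by (intro surj_card_le) (auto simp: finite_simple_graph_def)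
  then show ?thesis using vs distinct_card by metis
qed

lemma num_inj: "a \<in> alphabet I \<Longrightarrow> b \<in> alphabet I \<Longrightarrow> num a = num b \<longleftrightarrow> a = b"
  using num by (auto simp: bij_betw_def inj_on_def)

lemma num_less: "a \<in> alphabet I \<Longrightarrow> num a < card (alphabet I)"
  using num by (auto simp: bij_betw_def)

lemma vs_in: "v < n \<Longrightarrow> vs ! v \<in> fst (graph I)"
  using vs(2) nth_mem by blast

lemma vs_color: "v < n \<Longrightarrow> coloring I (vs ! v) \<in> alphabet I"
  by (rule coloring_in[OF vs_in])

lemma word_letter: "i < n \<Longrightarrow> word I ! i \<in> alphabet I"
  using word_in length_word nth_mem by (metis subsetD)

lemma bij_vs: "bij_betw (nth vs) {..<n} (fst (graph I))"
  using bij_betw_nth[OF vs(1)] vs(2) by blast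

lemma colored_graph: "colored_graph n (inp_adj x) (inp_col x) (inp_word x)"
proof
  fix u v assume "u < n" "v < n"
  then show "inp_adj x u v \<longleftrightarrow> inp_adj x v u" by (simp only: x_adj insert_commute)
next
  fix v assume v: "v < n"
  have "{vs ! v, vs ! v} \<notin> snd (graph I)"
    using finite_simple unfolding finite_simple_graph_def by force
  then show "\<not> inp_adj x v v" by (simp only: x_adj[OF v v] not_False_eq_True)
next
  fix v assume v: "v < n"
  then show "inp_col x v < n"
    using num_less[OF vs_color[OF v]] alphabet_le by (simp only: x_col)
next
  fix a
  have A: "{v. v < n \<and> inp_col x v = a} = {v. v < n \<and> num (coloring I (vs ! v)) = a}"
    using x_col by auto
  have B: "{i. i < n \<and> inp_word x i = a} = {i. i < n \<and> num (word I ! i) = a}"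
    using x_word by auto
  show "card {v. v < n \<and> inp_col x v = a} = card {i. i < n \<and> inp_word x i = a}"
  proof (cases "a \<in> num ` alphabet I")
    case True
    then obtain c where c: "c \<in> alphabet I" "a = num c" by blast
    have "{i. i < n \<and> num (word I ! i) = a} = {i. i < length (word I) \<and> word I ! i = c}"
      using c num_inj word_letter by (auto simp: length_word)
    then have 1: "card {i. i < n \<and> num (word I ! i) = a} = count_list (word I) c"
      by (simp add: count_list_eq_length_filter length_filter_conv_card eq_commute)
    have "nth vs ` {v. v < n \<and> num (coloring I (vs ! v)) = a} = color_class I c"
    proof (intro equalityI subsetI)
      fix v assume "v \<in> nth vs ` {v. v < n \<and> num (coloring I (vs ! v)) = a}"
      then show "v \<in> color_class I c"
        using c num_inj vs_color vs_in by (auto simp: color_class_def)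
    next
      fix v assume v: "v \<in> color_class I c"
      then have "v \<in> set vs" using vs(2) by (simp add: color_class_def)
      then obtain k where "k < n" "vs ! k = v" unfolding in_set_conv_nth by blast
      then show "v \<in> nth vs ` {v. v < n \<and> num (coloring I (vs ! v)) = a}"
        using v c by (auto simp: color_class_def)
    qed
    moreover have "inj_on (nth vs) {v. v < n \<and> num (coloring I (vs ! v)) = a}"
      using vs(1) by (auto intro!: inj_on_nth)
    ultimately have "card {v. v < n \<and> num (coloring I (vs ! v)) = a} = card (color_class I c)"
      by (metis card_image)
    then show ?thesis unfolding A B using 1 count_word[OF c(1)] by simp
  next
    \<comment> \<open>A number that names no letter has an empty class on both sides.\<close>
    case False
    then have "{v. v < n \<and> num (coloring I (vs ! v)) = a} = {}" "{i. i < n \<and> num (word I ! i) = a} = {}"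
      using vs_color word_letter by auto
    then show ?thesis unfolding A B by (simp only: card.empty)
  qed
qed

lemma bij_Suc: "bij_betw Suc {..<n} {1..n}"
  by (rule bij_betw_byWitness[where f' = "\<lambda>i. i - 1"]) auto

lemma realizable_imp_has_decoder:
  assumes "realizable n (inp_adj x) (inp_col x) (inp_word x)"
  shows "has_decoder I"
proof -
  from assms obtain D g where g: "bij_betw g {..<n} {..<n}"
    and lab: "\<And>v. v < n \<Longrightarrow> inp_word x (g v) = inp_col x v"
    and D: "\<And>u v. u < n \<Longrightarrow> v < n \<Longrightarrow> g u < g v \<Longrightarrow> inp_adj x u v \<longleftrightarrow> (inp_col x u, inp_col x v) \<in> D"
    unfolding realizable_def by blast
  define h where "h = inv_into {..<n} (nth vs)"
  have h: "bij_betw h (fst (graph I)) {..<n}" unfolding h_def by (rule bij_betw_inv_into[OF bij_vs])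
  have h_less: "h v < n" and vs_h: "vs ! h v = v" if "v \<in> fst (graph I)" for v
    using bij_betwE[OF h] bij_betw_inv_into_right[OF bij_vs that] that by (auto simp: h_def)
  \<comment> \<open>\<open>num\<close> is controlled only on the alphabet, so the relation is pulled
    back to pairs of letters from there. The \<open>Suc\<close> below accounts for positions counted
    from 1.\<close>
  let ?D = "{(a, b) \<in> alphabet I \<times> alphabet I. (num a, num b) \<in> D}"
  let ?f = "Suc \<circ> (g \<circ> h)"
  have f: "bij_betw ?f (fst (graph I)) {1..length (word I)}"
    unfolding length_word by (intro bij_betw_trans[OF bij_betw_trans[OF h g] bij_Suc])
  have label: "letter_at (word I) (?f v) = coloring I v" if v: "v \<in> fst (graph I)" for v
  proof -
    have less: "g (h v) < n" using bij_betwE[OF g] h_less[OF v] by auto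
    have "num (word I ! g (h v)) = num (coloring I v)"
      using lab[OF h_less[OF v]] x_word[OF less] x_col[OF h_less[OF v]] vs_h[OF v] by simp
    then show ?thesis
      using num_inj word_letter[OF less] coloring_in[OF v] by (simp add: letter_at_def)
  qed
  have edge: "{u, v} \<in> snd (graph I) \<longleftrightarrow> (coloring I u, coloring I v) \<in> ?D"
    if u: "u \<in> fst (graph I)" and v: "v \<in> fst (graph I)" and lt: "?f u < ?f v" for u v
  proof -
    have "inp_adj x (h u) (h v) \<longleftrightarrow> (inp_col x (h u), inp_col x (h v)) \<in> D"
      using D[OF h_less[OF u] h_less[OF v]] lt by simp
    then have "{u, v} \<in> snd (graph I) \<longleftrightarrow> (num (coloring I u), num (coloring I v)) \<in> D"
      by (simp only: x_adj[OF h_less[OF u] h_less[OF v]] x_col[OF h_less[OF u]]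
          x_col[OF h_less[OF v]] vs_h[OF u] vs_h[OF v])
    then show ?thesis using coloring_in u v by simp
  qed
  show ?thesis
    unfolding has_decoder_iff[OF finite_simple]
    by (rule exI[of _ ?D], intro conjI exI[of _ ?f] ballI impI f label edge) auto
qed

lemma has_decoder_imp_realizable:
  assumes "has_decoder I"
  shows "realizable n (inp_adj x) (inp_col x) (inp_word x)"
proof -
  from assms obtain D f where DD: "D \<subseteq> alphabet I \<times> alphabet I"
    and f: "bij_betw f (fst (graph I)) {1..n}"
    and lab: "\<And>v. v \<in> fst (graph I) \<Longrightarrow> letter_at (word I) (f v) = coloring I v"
    and D: "\<And>u v. u \<in> fst (graph I) \<Longrightarrow> v \<in> fst (graph I) \<Longrightarrow> f u < f v \<Longrightarrow>
        {u, v} \<in> snd (graph I) \<longleftrightarrow> (coloring I u, coloring I v) \<in> D"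
    unfolding has_decoder_iff[OF finite_simple] length_word by blast
  let ?D = "(\<lambda>(a, b). (num a, num b)) ` D"
  let ?g = "inv_into {..<n} Suc \<circ> (f \<circ> nth vs)"
  have g: "bij_betw ?g {..<n} {..<n}"
    by (intro bij_betw_trans[OF bij_betw_trans[OF bij_vs f]] bij_betw_inv_into bij_Suc)
  have g_Suc: "Suc (?g v) = f (vs ! v)" and g_less: "?g v < n" if "v < n" for v
    using bij_betw_inv_into_right[OF bij_Suc, of "f (vs ! v)"] bij_betwE[OF f] vs_in[OF that]
      bij_betwE[OF g] that by auto
  have label: "inp_word x (?g v) = inp_col x v" if v: "v < n" for v
  proof -
    have "word I ! ?g v = coloring I (vs ! v)"
      using lab[OF vs_in[OF v]] unfolding letter_at_def g_Suc[OF v, symmetric] by (simp only: diff_Suc_1)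
    then show ?thesis by (simp only: x_word[OF g_less[OF v]] x_col[OF v])
  qed
  have edge: "inp_adj x u v \<longleftrightarrow> (inp_col x u, inp_col x v) \<in> ?D"
    if u: "u < n" and v: "v < n" and lt: "?g u < ?g v" for u v
  proof -
    have "f (vs ! u) < f (vs ! v)" using lt g_Suc[OF u] g_Suc[OF v] by linarith
    then have "{vs ! u, vs ! v} \<in> snd (graph I) \<longleftrightarrow> (coloring I (vs ! u), coloring I (vs ! v)) \<in> D"
      using D vs_in u v by blast
    also have "\<dots> \<longleftrightarrow> (num (coloring I (vs ! u)), num (coloring I (vs ! v))) \<in> ?D"
      using DD num_inj vs_color[OF u] vs_color[OF v] by force
    finally show ?thesis by (simp only: x_adj[OF u v] x_col[OF u] x_col[OF v])
  qed
  show ?thesis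
    unfolding realizable_def using g label edge by blast
qed

lemma decide_has_decoder: "decide x (\<lambda>_. 0) 0 \<noteq> 0 \<longleftrightarrow> has_decoder I"
  using decide_correct[of x] colored_graph.realizable_iff_satisfiable[OF colored_graph]
    realizable_imp_has_decoder has_decoder_imp_realizable by (auto simp: x_0)

text \<open>The input size counts binary digits, so in general an entry could be exponential in it.
  Here the entries are so small that the input size itself can serve as the initial bound
  \<open>M\<close>.\<close>

lemma entry_le: "k \<in> set xs \<Longrightarrow> k \<le> length xs"
proof -
  assume "k \<in> set xs"
  moreover have "num (coloring I v) \<le> n" if "v \<in> set vs" for v
    using num_less[OF coloring_in[of v]] vs(2) alphabet_le that by simp
  moreover have "num a \<le> n" if "a \<in> set (word I)" for a
    using num_less[of a] word_in alphabet_le that by (meson less_imp_le order_trans subsetD)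
  ultimately have "k \<le> n \<or> k \<le> 1"
    using alphabet_le unfolding xs by (auto split: if_splits)
  then show ?thesis by (auto simp: length_xs)
qed

lemma bounded_input: "bounded_by (input_size xs) (input_memory xs)"
proof -
  have "length xs \<le> input_size xs"
    unfolding input_size_def by (induction xs) (auto simp: bits_def)
  then have "xs ! i \<le> input_size xs" if "i < length xs" for i
    using entry_le[OF nth_mem[OF that]] by simp
  then show ?thesis by (simp add: bounded_by_def input_memory_def)
qed

end

lemma encodesE:
  assumes "is_instance I" "encodes I xs"
  obtains vs num where "encoded_instance I vs num xs"
  using assms unfolding encodes_def encoded_instance_def by blast

theorem theorem2:
  shows "\<exists>p. decides_in_polynomial_time p
           (is_instance :: (nat, nat) instance_data \<Rightarrow> bool) encodes has_decoder"
proof -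
  obtain p where "polytime p (\<lambda>s s'. s' 1 = decide (s 0) (s 1))"
    using polytime_decision[OF computable_decide] by blast
  then obtain r c :: "nat poly" where p: "\<And>s M. bounded_by M s \<Longrightarrow>
    \<exists>t s'. exec p s t s' \<and> t \<le> poly c M \<and> bounded_by (M + poly r (s 0 0)) s' \<and> s' 0 = s 0 \<and>
           s' 1 = decide (s 0) (s 1)"
    unfolding polytime_def by blast
  have "decides_in_polynomial_time p is_instance encodes
      (has_decoder :: (nat, nat) instance_data \<Rightarrow> bool)"
    unfolding decides_in_polynomial_time_def
  proof (intro exI[of _ c] allI impI)
    fix I :: "(nat, nat) instance_data" and xs
    assume "is_instance I" "encodes I xs"
    then obtain vs num where "encoded_instance I vs num xs" by (rule encodesE)
    then interpret encoded_instance I vs num xs .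
    \<comment> \<open>Array 1 holds no marks at the start, as \<open>decide_correct\<close>
      requires.\<close>
    have "input_memory xs 1 = (\<lambda>_. 0)" by (simp add: input_memory_def)
    with p[OF bounded_input] obtain t s where "exec p (input_memory xs) t s" "t \<le> poly c (input_size xs)"
      "s 1 = decide x (\<lambda>_. 0)" by auto
    then show "\<exists>t s. exec p (input_memory xs) t s \<and> t \<le> poly c (input_size xs) \<and>
        (accepting s \<longleftrightarrow> has_decoder I)"
      using decide_has_decoder unfolding accepting_def by metis
  qed
  then show ?thesis by blast
qed

end
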